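(* Let $\mathscr{X}$ be a Hilbert ${\mathscr A}$-module over a $C^*$-algebra $\mathscr A$ and let $x , y\in \mathscr{X}$. Then the following statements are mutually equivalent: (i) $x\parallel y$; (ii) $\langle x, x\rangle\parallel\langle x, y\rangle$ and $\|\langle x, y\rangle\|=\|x\|\|y\|$; (iii) $r(\langle x, y\rangle)=\|\langle x, y\rangle\|=\|x\|\|y\|$; (iv) $\|\langle x, x+\lambda y\rangle\|=\|x\|(\|x\|+\|y\|)$ for some $\lambda\in\mathbb{T}$.
   Context: A Hilbert $\mathscr A$-module is a right $\mathscr A$-module $\mathscr{X}$ (a complex linear space with compatible scalar multiplication) with an $\mathscr A$-valued inner product $\langle\cdot,\cdot\rangle$ that is $\mathbb{C}$-linear in the second variable and satisfies $\langle x, ya\rangle=\langle x, y\rangle a$, $\langle x, y\rangle^*=\langle y, x\rangle$, $\langle x,x\rangle\ge 0$ with $\langle x,x\rangle=0$ iff $x=0$, and which is complete in the norm $\|x\|=\|\langle x,x\rangle\|^{1/2}$. $C^*$-algebras are not assumed unital; $r(\cdot)$ is the spectral radius. $\mathbb{T}=\{\alpha\in\mathbb{C}:|\alpha|=1\}$. For elements $u,v$ of a normed space (here $\mathscr{X}$ or $\mathscr{A}$), $u\parallel v$ means that $\|u+\lambda v\|=\|u\|+\|v\|$ for some $\lambda\in\mathbb{T}$. *)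

theory Defs
  imports "HOL-Analysis.Analysis"
begin

class complex_vector = real_vector +
  fixes scaleC :: "complex \<Rightarrow> 'a \<Rightarrow> 'a" (infixr "*\<^sub>C" 75)
  assumes scaleC_add_right: "c *\<^sub>C (x + y) = c *\<^sub>C x + c *\<^sub>C y"
    and scaleC_add_left: "(c + d) *\<^sub>C x = c *\<^sub>C x + d *\<^sub>C x"
    and scaleC_scaleC: "c *\<^sub>C (d *\<^sub>C x) = (c * d) *\<^sub>C x"
    and scaleR_scaleC: "r *\<^sub>R x = complex_of_real r *\<^sub>C x"

class complex_normed_vector = complex_vector + real_normed_vector +
  assumes norm_scaleC: "norm (c *\<^sub>C x) = cmod c * norm x"

class complex_normed_algebra = complex_normed_vector + real_normed_algebra +
  assumes scaleC_mult_left: "(c *\<^sub>C a) * b = c *\<^sub>C (a * b)"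
    and scaleC_mult_right: "a * (c *\<^sub>C b) = c *\<^sub>C (a * b)"

text \<open>No unit is required, and the zero algebra is allowed.\<close>

class cstar_algebra = complex_normed_algebra + banach +
  fixes adj :: "'a \<Rightarrow> 'a"
  assumes adj_adj: "adj (adj a) = a"
    and adj_add: "adj (a + b) = adj a + adj b"
    and adj_scaleC: "adj (c *\<^sub>C a) = cnj c *\<^sub>C adj a"
    and adj_mult: "adj (a * b) = adj b * adj a"
    and cstar_identity: "norm (adj a * a) = (norm a)\<^sup>2"

text \<open>
  Multiplication in the unitization \<open>A \<oplus> \<complex>\<close>, whose unit is \<open>(0, 1)\<close>. The spectrum is
  always formed there, by the usual convention for algebras that need not have a unit. If \<open>A\<close>
  happens to be unital, this differs from the spectrum relative to the unit of \<open>A\<close> at most by the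
  point \<open>0\<close>, which affects neither the spectral radius nor positivity (and for the zero algebra
  it gives spectral radius \<open>0\<close>). In particular the spectrum always contains \<open>0\<close>, so the supremum in
  \<open>spectral_radius\<close> is over a nonempty set.
\<close>

definition unitization_mult ::
    "'a::complex_normed_algebra \<times> complex \<Rightarrow> 'a \<times> complex \<Rightarrow> 'a \<times> complex" where
  "unitization_mult u v =
     (fst u * fst v + snd u *\<^sub>C fst v + snd v *\<^sub>C fst u, snd u * snd v)"

definition unitization_invertible :: "'a::complex_normed_algebra \<times> complex \<Rightarrow> bool" where
  "unitization_invertible u \<longleftrightarrow>
     (\<exists>v. unitization_mult u v = (0, 1) \<and> unitization_mult v u = (0, 1))"

definition spectrum :: "'a::complex_normed_algebra \<Rightarrow> complex set" where
  "spectrum a = {z. \<not> unitization_invertible (a, - z)}"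

definition spectral_radius :: "'a::complex_normed_algebra \<Rightarrow> real" where
  "spectral_radius a = (SUP z\<in>spectrum a. cmod z)"

definition positive :: "'a::cstar_algebra \<Rightarrow> bool" where
  "positive a \<longleftrightarrow> adj a = a \<and> spectrum a \<subseteq> \<real>\<^sub>\<ge>\<^sub>0"

definition ip_norm :: "('x \<Rightarrow> 'x \<Rightarrow> 'a::cstar_algebra) \<Rightarrow> 'x \<Rightarrow> real" where
  "ip_norm ip x = sqrt (norm (ip x x))"

text \<open>
  The norm of the module is induced by the inner product, so the completeness axiom is spelled out
  for \<open>ip_norm ip\<close> instead of using the norm of a type class.
\<close>

locale hilbert_module =
  fixes act :: "'x::complex_vector \<Rightarrow> 'a::cstar_algebra \<Rightarrow> 'x"
    and ip :: "'x \<Rightarrow> 'x \<Rightarrow> 'a"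
  assumes act_add_left: "act (x + y) a = act x a + act y a"
    and act_add_right: "act x (a + b) = act x a + act x b"
    and act_mult: "act x (a * b) = act (act x a) b"
    and act_scaleC_left: "act (c *\<^sub>C x) a = c *\<^sub>C act x a"
    and act_scaleC_right: "act x (c *\<^sub>C a) = c *\<^sub>C act x a"
    and ip_add_right: "ip x (y + z) = ip x y + ip x z"
    and ip_scaleC_right: "ip x (c *\<^sub>C y) = c *\<^sub>C ip x y"
    and ip_act_right: "ip x (act y a) = ip x y * a"
    and adj_ip: "adj (ip x y) = ip y x"
    and ip_positive: "positive (ip x x)"
    and ip_eq_zero_iff: "ip x x = 0 \<longleftrightarrow> x = 0"
    and complete: "(\<And>e. e > 0 \<Longrightarrow> \<exists>N. \<forall>m\<ge>N. \<forall>n\<ge>N. ip_norm ip (s m - s n) < e)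
      \<Longrightarrow> \<exists>l. (\<lambda>n::nat. ip_norm ip (s n - l)) \<longlonglongrightarrow> 0"

text \<open>
  Norm-parallelism with respect to a norm \<open>N\<close>: it is used with \<open>N = ip_norm ip\<close> on the module and
  with \<open>N = norm\<close> on the algebra.
\<close>

definition norm_parallel :: "('v::complex_vector \<Rightarrow> real) \<Rightarrow> 'v \<Rightarrow> 'v \<Rightarrow> bool" where
  "norm_parallel N u v \<longleftrightarrow> (\<exists>c. cmod c = 1 \<and> N (u + c *\<^sub>C v) = N u + N v)"

end

theory Submission
  imports Defs
begin

text \<open>
  Write \<open>b = \<langle>x, y\<rangle>\<close>. Expanding \<open>\<langle>x + \<lambda>y, x + \<lambda>y\<rangle>\<close> shows that \<open>\<parallel>x + \<lambda>y\<parallel> = \<parallel>x\<parallel> + \<parallel>y\<parallel>\<close> forces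
  \<open>\<parallel>\<lambda>b + (\<lambda>b)\<^sup>*\<parallel> = 2\<parallel>x\<parallel>\<parallel>y\<parallel>\<close>, which by the Cauchy--Schwarz inequality is the largest possible value. So
  everything rests on what the equality \<open>\<parallel>b + b\<^sup>*\<parallel> = 2\<parallel>b\<parallel>\<close> says about the spectrum of \<open>b\<close>, and,
  conversely, on how a spectral value of modulus \<open>\<parallel>b\<parallel>\<close> makes \<open>b + b\<^sup>*\<close> large. States and the order
  theory of positive elements are avoided: all estimates are made with norms in the unitization, a
  unital C*-algebra under the larger of the scalar modulus and the operator norm on \<open>A\<close>.

  \<^item> An element with \<open>\<parallel>a\<^bsup>N\<^esup>\<parallel> = \<parallel>a\<parallel>\<^bsup>N\<^esup>\<close> for all powers \<open>N\<close> of two has a spectral value of modulus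
    \<open>\<parallel>a\<parallel>\<close> (\<open>exists_spectral_value\<close>). This part of the spectral radius formula is proved without complex
    analysis, by averaging resolvents over square roots.
  \<^item> If \<open>\<parallel>b + b\<^sup>*\<parallel> = 2\<parallel>b\<parallel>\<close> with \<open>\<parallel>b\<parallel> = 1\<close>, then \<open>(b + b\<^sup>*)\<^bsup>N\<^esup>\<close> has norm \<open>2\<^bsup>N\<^esup>\<close> for such \<open>N\<close>. It is a
    sum of \<open>2\<^bsup>N\<^esup>\<close> words of norm at most one, hence the word \<open>b\<^bsup>N\<^esup>\<close> has norm one. This gives the spectral
    condition from parallelism.
  \<^item> If \<open>\<parallel>b\<parallel>\<close> itself lies in the spectrum of \<open>b\<close>, then \<open>\<parallel>b + r\<parallel> \<ge> \<parallel>b\<parallel> + r\<close> for \<open>r > 0\<close>. Squaring this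
    with the C*-identity gives \<open>\<parallel>r + b + b\<^sup>*\<parallel> \<ge> r + 2\<parallel>b\<parallel>\<close>.
  \<^item> A positive \<open>w\<close> satisfies \<open>\<parallel>r - w\<parallel> \<le> r\<close> for \<open>r \<ge> \<parallel>w\<parallel>\<close>, so \<open>\<parallel>r + k\<parallel> \<le> r + \<parallel>w + k\<parallel>\<close>. Comparing this upper
    bound with a lower bound for \<open>\<parallel>r + k\<parallel>\<close> gives the Cauchy--Schwarz inequality (\<open>k\<close> a
    square) and the way back from the spectral condition (\<open>k\<close> a real part), with \<open>w = \<langle>z, z\<rangle>\<close> for a suitable \<open>z\<close>.

  The condition on \<open>\<parallel>\<langle>x, x + \<lambda>y\<rangle>\<parallel>\<close> follows by observing that a vector \<open>x\<close> that is parallel to \<open>y\<close> with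
  factor \<open>\<lambda>\<close> is also parallel to \<open>x + \<lambda>y\<close>, and that parallel vectors attain equality in
  Cauchy--Schwarz. Its equivalence with parallelism in the algebra is the equality case of the triangle inequality.
\<close>

section \<open>Complex scalars\<close>

lemma scaleC_zero_left [simp]: "0 *\<^sub>C (x::'a::complex_vector) = 0"
  using scaleC_add_left[of 0 0 x] by simp

lemma scaleC_zero_right [simp]: "c *\<^sub>C (0::'a::complex_vector) = 0"
  using scaleC_add_right[of c 0 "0::'a"] by simp

lemma scaleC_one [simp]: "1 *\<^sub>C (x::'a::complex_vector) = x"
  using scaleR_scaleC[of 1 x] by simp

lemma scaleC_minus_left: "(- c) *\<^sub>C (x::'a::complex_vector) = - (c *\<^sub>C x)"
  using scaleC_add_left[of c "- c" x] by (simp add: eq_neg_iff_add_eq_0 add.commute)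

lemma scaleC_minus_right: "c *\<^sub>C (- x::'a::complex_vector) = - (c *\<^sub>C x)"
  using scaleC_add_right[of c x "- x"] by (simp add: eq_neg_iff_add_eq_0 add.commute)

lemma scaleC_diff_right: "c *\<^sub>C (x - y::'a::complex_vector) = c *\<^sub>C x - c *\<^sub>C y"
  using scaleC_add_right[of c x "- y"] by (simp add: scaleC_minus_right)

lemma scaleC_diff_left: "(c - d) *\<^sub>C (x::'a::complex_vector) = c *\<^sub>C x - d *\<^sub>C x"
  using scaleC_add_left[of c "- d" x] by (simp add: scaleC_minus_left)

section \<open>Spectral values of maximal modulus in Banach algebras\<close>

definition is_inverse :: "'a::monoid_mult \<Rightarrow> 'a \<Rightarrow> bool" where
  "is_inverse a b \<longleftrightarrow> a * b = 1 \<and> b * a = 1"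

definition unital_spectrum :: "'a::{complex_normed_algebra, real_normed_algebra_1} \<Rightarrow> complex set" where
  "unital_spectrum a = {z. \<nexists>b. is_inverse (a - z *\<^sub>C 1) b}"

lemma is_inverse_scaleC:
  fixes a :: "'a::{complex_normed_algebra, real_normed_algebra_1}"
  assumes "is_inverse a b" "c \<noteq> 0"
  shows "is_inverse (c *\<^sub>C a) (inverse c *\<^sub>C b)"
  using assms by (simp add: is_inverse_def scaleC_mult_left scaleC_mult_right scaleC_scaleC)

lemma neumann_inverse:
  fixes a :: "'a::{real_normed_algebra_1, banach}"
  assumes "norm a < 1"
  shows "\<exists>b. is_inverse (1 - a) b"
proof -
  have s: "summable (\<lambda>n. a ^ n)"
    using assms by (rule complete_algebra_summable_geometric)
  have *: "(\<Sum>n. a ^ Suc n) = (\<Sum>n. a ^ n) - 1"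
    using suminf_split_head[OF s] by simp
  have "a * (\<Sum>n. a ^ n) = (\<Sum>n. a ^ n) - 1"
    using suminf_mult[OF s, of a] * by simp
  moreover have "(\<Sum>n. a ^ n) * a = (\<Sum>n. a ^ n) - 1"
    using suminf_mult2[OF s, of a] * by (simp add: power_commutes)
  ultimately show ?thesis
    by (intro exI[of _ "\<Sum>n. a ^ n"]) (simp add: is_inverse_def left_diff_distrib right_diff_distrib)
qed

lemma unital_spectrum_norm_le:
  fixes a :: "'a::{complex_normed_algebra, real_normed_algebra_1, banach}"
  assumes "z \<in> unital_spectrum a"
  shows "cmod z \<le> norm a"
proof (rule ccontr)
  assume "\<not> cmod z \<le> norm a"
  then have lt: "norm a < cmod z" by simp
  then have z: "z \<noteq> 0" by auto
  have "norm (inverse z *\<^sub>C a) = norm a / cmod z"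
    by (simp only: norm_scaleC norm_inverse divide_inverse_commute)
  with lt z have "norm (inverse z *\<^sub>C a) < 1" by simp
  then obtain b where "is_inverse (1 - inverse z *\<^sub>C a) b"
    using neumann_inverse by blast
  then have "is_inverse ((- z) *\<^sub>C (1 - inverse z *\<^sub>C a)) (inverse (- z) *\<^sub>C b)"
    using z by (intro is_inverse_scaleC) auto
  moreover have "(- z) *\<^sub>C (1 - inverse z *\<^sub>C a) = a - z *\<^sub>C 1"
    using z by (simp add: scaleC_diff_right scaleC_minus_left scaleC_scaleC)
  ultimately show False
    using assms by (auto simp: unital_spectrum_def)
qed

text \<open>
  With both inverses given, everything follows from \<open>u - v = u (b - a) v\<close>: no series is needed.
\<close>

lemma resolvent_perturbation:
  fixes a :: "'a::real_normed_algebra_1"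
  assumes "is_inverse a u" "is_inverse b v" "norm (a - b) * norm u \<le> 1/2"
  shows "norm v \<le> 2 * norm u"
    and "norm (u - v) \<le> 2 * (norm u)\<^sup>2 * norm (a - b)"
proof -
  have eq: "u - v = u * (b - a) * v"
  proof -
    have "u * (b - a) * v = u * (b * v) - (u * a) * v"
      by (simp add: algebra_simps)
    then show ?thesis using assms by (simp add: is_inverse_def)
  qed
  have le: "norm (u - v) \<le> norm u * norm (a - b) * norm v"
    unfolding eq by (metis norm_mult_ineq norm_minus_commute mult_right_mono norm_ge_zero order_trans)
  also have "\<dots> \<le> (1/2) * norm v"
    using assms(3) by (intro mult_right_mono) (auto simp: mult.commute)
  finally have "norm (u - v) \<le> (1/2) * norm v" .
  then show v: "norm v \<le> 2 * norm u"
    using norm_triangle_ineq3[of v u] by (simp add: norm_minus_commute)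
  have "norm u * norm (a - b) * norm v \<le> norm u * norm (a - b) * (2 * norm u)"
    using v by (intro mult_left_mono) auto
  with le show "norm (u - v) \<le> 2 * (norm u)\<^sup>2 * norm (a - b)"
    by (simp add: power2_eq_square algebra_simps)
qed

text \<open>
  The perturbation estimate bounds resolvents near each point of the circle, and finitely many of
  these neighbourhoods cover it.
\<close>

lemma resolvent_bounded_on_circle:
  fixes a :: "'a::{complex_normed_algebra, real_normed_algebra_1}"
  assumes inv: "\<And>z. cmod z = 1 \<Longrightarrow> \<exists>u. is_inverse (1 - z *\<^sub>C a) u"
  shows "\<exists>K>0. \<forall>z u. cmod z = 1 \<longrightarrow> is_inverse (1 - z *\<^sub>C a) u \<longrightarrow> norm u \<le> K"
proof -
  obtain U where U: "\<And>z. cmod z = 1 \<Longrightarrow> is_inverse (1 - z *\<^sub>C a) (U z)"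
    using inv by metis
  \<comment> \<open>The radius makes \<open>\<parallel>(w - z) a\<parallel> \<parallel>U z\<parallel>\<close> at most \<open>1/2\<close> on the ball, as the perturbation bound requires.\<close>
  define r where "r z = 1 / (2 * (1 + norm a) * (1 + norm (U z)))" for z
  have r: "r z > 0" for z
    unfolding r_def by (intro divide_pos_pos mult_pos_pos) (auto intro: add_pos_nonneg)
  have loc: "norm u \<le> 2 * norm (U z)"
    if "cmod z = 1" "is_inverse (1 - w *\<^sub>C a) u" "w \<in> ball z (r z)" for z w u
  proof (rule resolvent_perturbation(1)[OF U[OF that(1)] that(2)])
    have "norm (1 - z *\<^sub>C a - (1 - w *\<^sub>C a)) = norm ((w - z) *\<^sub>C a)"
      by (simp add: scaleC_diff_left)
    also have "\<dots> \<le> r z * norm a"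
      using that(3) by (auto simp: norm_scaleC dist_norm norm_minus_commute intro!: mult_right_mono)
    finally have "norm (1 - z *\<^sub>C a - (1 - w *\<^sub>C a)) * norm (U z) \<le> r z * norm a * norm (U z)"
      by (intro mult_right_mono) auto
    also have "\<dots> \<le> r z * (1 + norm a) * (1 + norm (U z))"
      using r[of z] by (intro mult_mono) auto
    also have "\<dots> = 1/2"
      unfolding r_def by (simp add: divide_simps) (smt (verit) norm_ge_zero mult_pos_pos)
    finally show "norm (1 - z *\<^sub>C a - (1 - w *\<^sub>C a)) * norm (U z) \<le> 1/2" .
  qed
  obtain D where D: "D \<subseteq> sphere 0 1" "finite D" "sphere 0 (1::real) \<subseteq> (\<Union>z\<in>D. ball z (r z))"
  proof (rule compactE_image[of "sphere (0::complex) 1" "sphere 0 1" "\<lambda>z. ball z (r z)"])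
    show "sphere 0 1 \<subseteq> (\<Union>z\<in>sphere 0 1. ball z (r z))"
      using r by (auto intro!: bexI)
  qed (auto intro: that)
  define K where "K = 1 + (\<Sum>z\<in>D. 2 * norm (U z))"
  have "norm u \<le> K" if "cmod w = 1" "is_inverse (1 - w *\<^sub>C a) u" for w u
  proof -
    obtain z where z: "z \<in> D" "w \<in> ball z (r z)"
      using D(3) \<open>cmod w = 1\<close> by (auto simp: subset_iff)
    then have "norm u \<le> 2 * norm (U z)"
      using loc[of z w u] D(1) that by auto
    also have "\<dots> \<le> (\<Sum>z\<in>D. 2 * norm (U z))"
      using D(2) z(1) by (intro member_le_sum) auto
    finally show ?thesis by (simp add: K_def)
  qed
  moreover have "K > 0"
    unfolding K_def by (intro add_pos_nonneg sum_nonneg) auto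
  ultimately show ?thesis by blast
qed

text \<open>
  The relation asks for closeness on the whole circle, so that it survives squaring: every unimodular
  \<open>z\<close> is a square \<open>w\<^sup>2\<close>, and
  \<open>(1 - w\<^sup>2a\<^sup>2)\<^bsup>-1\<^esup> = ((1 - wa)\<^bsup>-1\<^esup> + (1 + wa)\<^bsup>-1\<^esup>) / 2\<close> averages two resolvents of \<open>a\<close> on the circle.
\<close>

definition resolvents_close where
  "resolvents_close e a b \<longleftrightarrow> (\<forall>z. cmod z = 1 \<longrightarrow>
     (\<exists>u v. is_inverse (1 - z *\<^sub>C a) u \<and> is_inverse (1 - z *\<^sub>C b) v \<and> norm (u - v) \<le> e))"

lemma is_inverse_square:
  fixes a :: "'a::{complex_normed_algebra, real_normed_algebra_1}"
  assumes "is_inverse (1 - w *\<^sub>C a) u1" "is_inverse (1 - (- w) *\<^sub>C a) u2"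
  shows "is_inverse (1 - w\<^sup>2 *\<^sub>C a\<^sup>2) ((1/2) *\<^sub>R (u1 + u2))"
proof -
  define q where "q = w *\<^sub>C a"
  have m: "(- w) *\<^sub>C a = - q" "w\<^sup>2 *\<^sub>C a\<^sup>2 = q * q"
    by (simp_all add: q_def scaleC_minus_left scaleC_mult_left scaleC_mult_right scaleC_scaleC
        power2_eq_square)
  have 1: "(1 - q) * u1 = 1" "u1 * (1 - q) = 1" "(1 + q) * u2 = 1" "u2 * (1 + q) = 1"
    using assms by (simp_all add: is_inverse_def m q_def[symmetric])
  have f: "1 - q * q = (1 + q) * (1 - q)" "1 - q * q = (1 - q) * (1 + q)"
    by (simp_all add: algebra_simps)
  have "(1 - q * q) * (u1 + u2) = (1 + q) * ((1 - q) * u1) + (1 - q) * ((1 + q) * u2)"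
    using f by (metis distrib_left mult.assoc)
  then have A: "(1 - q * q) * (u1 + u2) = 2" by (simp add: 1)
  have "(u1 + u2) * (1 - q * q) = (u1 * (1 - q)) * (1 + q) + (u2 * (1 + q)) * (1 - q)"
    using f by (metis distrib_right mult.assoc)
  then have B: "(u1 + u2) * (1 - q * q) = 2" by (simp add: 1)
  have "(1/2) *\<^sub>R (2::'a) = 1"
    by (metis field_sum_of_halves one_add_one scaleR_add_left scaleR_add_right scaleR_one)
  then show ?thesis
    unfolding is_inverse_def m mult_scaleR_left mult_scaleR_right A B by simp
qed

lemma resolvents_close_square:
  fixes a :: "'a::{complex_normed_algebra, real_normed_algebra_1}"
  assumes "resolvents_close e a b"
  shows "resolvents_close e (a\<^sup>2) (b\<^sup>2)"
  unfolding resolvents_close_def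
proof (intro allI impI)
  fix z :: complex assume "cmod z = 1"
  define w where "w = csqrt z"
  have w: "w\<^sup>2 = z" "cmod w = 1" "cmod (- w) = 1"
    using \<open>cmod z = 1\<close> by (simp_all add: w_def)
  obtain u1 v1 where 1: "is_inverse (1 - w *\<^sub>C a) u1" "is_inverse (1 - w *\<^sub>C b) v1"
      "norm (u1 - v1) \<le> e"
    using assms w by (auto simp: resolvents_close_def)
  obtain u2 v2 where 2: "is_inverse (1 - (- w) *\<^sub>C a) u2" "is_inverse (1 - (- w) *\<^sub>C b) v2"
      "norm (u2 - v2) \<le> e"
    using assms w unfolding resolvents_close_def by blast
  have "(1/2) *\<^sub>R (u1 + u2) - (1/2) *\<^sub>R (v1 + v2) = (1/2) *\<^sub>R ((u1 - v1) + (u2 - v2))"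
    by (simp add: algebra_simps)
  then have "norm ((1/2) *\<^sub>R (u1 + u2) - (1/2) *\<^sub>R (v1 + v2)) = (1/2) * norm ((u1 - v1) + (u2 - v2))"
    by simp
  also have "\<dots> \<le> (1/2) * (e + e)"
    using 1(3) 2(3) norm_triangle_ineq[of "u1 - v1" "u2 - v2"] by auto
  finally show "\<exists>u v. is_inverse (1 - z *\<^sub>C a\<^sup>2) u \<and> is_inverse (1 - z *\<^sub>C b\<^sup>2) v \<and> norm (u - v) \<le> e"
    using is_inverse_square[OF 1(1) 2(1)] is_inverse_square[OF 1(2) 2(2)] w(1) by auto
qed

lemma resolvents_close_power:
  fixes a :: "'a::{complex_normed_algebra, real_normed_algebra_1}"
  assumes "resolvents_close e a b"
  shows "resolvents_close e (a ^ (2 ^ k)) (b ^ (2 ^ k))"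
proof (induction k)
  case (Suc k)
  then show ?case
    using resolvents_close_square[OF Suc] by (simp add: power_mult[symmetric] mult.commute)
qed (use assms in simp)

text \<open>
  An element \<open>t\<close> is small exactly when \<open>(1 - t)\<^bsup>-1\<^esup>\<close> is close to \<open>1\<close>, since \<open>(1 - t)\<^bsup>-1\<^esup> - 1 = t (1 - t)\<^bsup>-1\<^esup>\<close>.
\<close>

lemma norm_le_inverse_diff:
  fixes t :: "'a::real_normed_algebra_1"
  assumes "is_inverse (1 - t) u"
  shows "norm t \<le> norm (u - 1) * (1 + norm t)"
    and "norm t < 1 \<Longrightarrow> norm (u - 1) \<le> norm t / (1 - norm t)"
proof -
  have e: "u - 1 = t * u"
    using assms by (simp add: is_inverse_def algebra_simps)
  then have "t = (u - 1) - t * (u - 1)"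
    by (simp add: algebra_simps)
  then have "norm t \<le> norm (u - 1) + norm (t * (u - 1))"
    by (metis norm_triangle_ineq4)
  also have "\<dots> \<le> norm (u - 1) + norm t * norm (u - 1)"
    using norm_mult_ineq by auto
  finally show "norm t \<le> norm (u - 1) * (1 + norm t)" by (simp add: algebra_simps)
  assume t: "norm t < 1"
  have "u - 1 = t + t * (u - 1)"
    using e by (simp add: algebra_simps)
  then have "norm (u - 1) \<le> norm t + norm (t * (u - 1))"
    by (metis norm_triangle_ineq)
  also have "\<dots> \<le> norm t + norm t * norm (u - 1)"
    using norm_mult_ineq by auto
  finally show "norm (u - 1) \<le> norm t / (1 - norm t)"
    using t by (simp add: field_simps)
qed

text \<open>
  Suppose all resolvents on the circle existed. For \<open>s < 1\<close> close to \<open>1\<close> those of \<open>a\<close> and of \<open>sa\<close>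
  would be uniformly close, and so would those of \<open>a\<^bsup>N\<^esup>\<close> and \<open>(sa)\<^bsup>N\<^esup>\<close> for every power \<open>N\<close> of two,
  with the same tolerance. But \<open>(sa)\<^bsup>N\<^esup>\<close> tends to zero, which would make \<open>(1 - a\<^bsup>N\<^esup>)\<^bsup>-1\<^esup>\<close> close to \<open>1\<close> and
  hence \<open>a\<^bsup>N\<^esup>\<close> small, contradicting norm one.
\<close>

lemma exists_spectral_value_unit:
  fixes a :: "'a::{complex_normed_algebra, real_normed_algebra_1, banach}"
  assumes norm_power: "\<And>k. norm (a ^ (2 ^ k)) = 1"
  shows "\<exists>z. cmod z = 1 \<and> \<not> (\<exists>u. is_inverse (1 - z *\<^sub>C a) u)"
proof (rule ccontr)
  assume "\<not> ?thesis"
  then have inv: "\<And>z. cmod z = 1 \<Longrightarrow> \<exists>u. is_inverse (1 - z *\<^sub>C a) u" by blast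
  have na: "norm a = 1" using norm_power[of 0] by simp
  obtain K where K: "K > 0" "\<And>z u. cmod z = 1 \<Longrightarrow> is_inverse (1 - z *\<^sub>C a) u \<Longrightarrow> norm u \<le> K"
    using resolvent_bounded_on_circle[OF inv] by blast
  \<comment> \<open>The second entry allows the perturbation bound, the third turns it into the tolerance \<open>1/4\<close>.\<close>
  define d where "d = min (1/2) (min (1 / (2 * K)) (1 / (8 * K\<^sup>2)))"
  have d: "0 < d" "d < 1" "d * K \<le> 1/2" "2 * K\<^sup>2 * d \<le> 1/4"
  proof -
    show "0 < d" "d < 1" using K by (auto simp: d_def)
    have "d \<le> 1 / (2 * K)" "d \<le> 1 / (8 * K\<^sup>2)" by (auto simp: d_def)
    then show "d * K \<le> 1/2" "2 * K\<^sup>2 * d \<le> 1/4" using K(1) by (auto simp: field_simps)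
  qed
  define s where "s = 1 - d"
  define b where "b = s *\<^sub>R a"
  have s: "0 < s" "s < 1" using d by (auto simp: s_def)
  have "resolvents_close (1/4) a b"
    unfolding resolvents_close_def
  proof (intro allI impI)
    fix z :: complex assume z: "cmod z = 1"
    obtain u where u: "is_inverse (1 - z *\<^sub>C a) u" using inv z by blast
    have "norm (z *\<^sub>C b) < 1" using s z na by (simp add: b_def norm_scaleC)
    then obtain v where v: "is_inverse (1 - z *\<^sub>C b) v" using neumann_inverse by blast
    have "1 - z *\<^sub>C a - (1 - z *\<^sub>C b) = z *\<^sub>C (b - a)" by (simp add: scaleC_diff_right)
    also have "b - a = (- d) *\<^sub>R a" by (simp add: b_def s_def algebra_simps)
    finally have nd: "norm (1 - z *\<^sub>C a - (1 - z *\<^sub>C b)) = d"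
      using z na d by (simp add: norm_scaleC)
    have uK: "norm u \<le> K" using K(2) z u by blast
    have "d * norm u \<le> 1/2" using uK d by (smt (verit) mult_left_mono)
    then have "norm (u - v) \<le> 2 * (norm u)\<^sup>2 * d"
      using resolvent_perturbation(2)[OF u v] unfolding nd by simp
    also have "\<dots> \<le> 2 * K\<^sup>2 * d"
      using uK d by (intro mult_right_mono mult_left_mono power_mono) auto
    finally show "\<exists>u v. is_inverse (1 - z *\<^sub>C a) u \<and> is_inverse (1 - z *\<^sub>C b) v \<and> norm (u - v) \<le> 1/4"
      using u v d by fastforce
  qed
  then have close: "resolvents_close (1/4) (a ^ (2 ^ k)) (b ^ (2 ^ k))" for k
    by (rule resolvents_close_power)
  obtain n where n: "s ^ n < 1/8" using s real_arch_pow_inv[of "1/8" s] by auto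
  have "s ^ (2 ^ n) \<le> s ^ n" using s by (intro power_decreasing) (auto simp: less_imp_le[OF less_exp])
  with n have sn: "s ^ (2 ^ n) < 1/8" by simp
  define t where "t = a ^ (2 ^ n)"
  have bt: "norm (b ^ (2 ^ n)) < 1/8"
    using sn s norm_power[of n] by (simp add: b_def scaleR_power)
  obtain u v where uv: "is_inverse (1 - t) u" "is_inverse (1 - b ^ (2 ^ n)) v" "norm (u - v) \<le> 1/4"
    using close[of n] unfolding resolvents_close_def t_def by (metis norm_one scaleC_one)
  have "norm (v - 1) \<le> norm (b ^ (2 ^ n)) / (1 - norm (b ^ (2 ^ n)))"
    using norm_le_inverse_diff(2)[OF uv(2)] bt by auto
  also have "\<dots> < 1/4" using bt by (simp add: field_simps)
  finally have "norm (u - 1) < 1/2"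
    using uv(3) norm_triangle_ineq[of "u - v" "v - 1"] by simp
  moreover have "1 \<le> norm (u - 1) * 2"
    using norm_le_inverse_diff(1)[OF uv(1)] norm_power[of n] by (simp add: t_def)
  ultimately show False by simp
qed

lemma exists_spectral_value:
  fixes a :: "'a::{complex_normed_algebra, real_normed_algebra_1, banach}"
  assumes norm_power: "\<And>k. norm (a ^ (2 ^ k)) = norm a ^ (2 ^ k)"
  shows "\<exists>z\<in>unital_spectrum a. cmod z = norm a"
proof (cases "a = 0")
  case True
  then show ?thesis by (auto simp: unital_spectrum_def is_inverse_def intro!: bexI[of _ 0])
next
  case False
  define b where "b = (1 / norm a) *\<^sub>R a"
  have "norm (b ^ (2 ^ k)) = 1" for k
    using False by (simp add: b_def scaleR_power norm_power power_divide)
  then obtain z where z: "cmod z = 1" "\<And>u. \<not> is_inverse (1 - z *\<^sub>C b) u"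
    using exists_spectral_value_unit by blast
  have z0: "z \<noteq> 0" using z by auto
  define w where "w = norm a * inverse z"
  have "w \<in> unital_spectrum a"
    unfolding unital_spectrum_def
  proof (rule CollectI, rule notI)
    assume "\<exists>v. is_inverse (a - w *\<^sub>C 1) v"
    then obtain v where "is_inverse (a - w *\<^sub>C 1) v" ..
    then have "is_inverse ((- inverse w) *\<^sub>C (a - w *\<^sub>C 1)) (inverse (- inverse w) *\<^sub>C v)"
      using False z0 by (intro is_inverse_scaleC) (auto simp: w_def)
    moreover have "(- inverse w) *\<^sub>C (a - w *\<^sub>C 1) = 1 - z *\<^sub>C b"
      using False z0 by (simp add: w_def b_def scaleC_diff_right scaleC_minus_left scaleC_scaleC
          scaleR_scaleC field_simps)
    ultimately show False using z by metis
  qed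
  moreover have "cmod w = norm a" using z by (simp add: w_def norm_mult norm_inverse)
  ultimately show ?thesis by blast
qed

lemma unital_spectrum_shift:
  "z \<in> unital_spectrum (a + c *\<^sub>C 1) \<longleftrightarrow> z - c \<in> unital_spectrum a"
  by (simp add: unital_spectrum_def scaleC_diff_left algebra_simps)

section \<open>Norm estimates in unital C*-algebras\<close>

lemma adj_zero [simp]: "adj (0::'a::cstar_algebra) = 0"
  using adj_add[of "0::'a" 0] by simp

lemma adj_minus: "adj (- a::'a::cstar_algebra) = - adj a"
  using adj_add[of a "- a"] by (simp add: eq_neg_iff_add_eq_0 add.commute)

lemma adj_scaleR: "adj (r *\<^sub>R a) = r *\<^sub>R adj (a::'a::cstar_algebra)"
  using adj_scaleC[of "of_real r" a] by (simp add: scaleR_scaleC[symmetric])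

lemma adj_one [simp]: "adj (1::'a::{cstar_algebra, real_normed_algebra_1}) = 1"
  using adj_mult[of "1::'a" "adj 1"] by (simp add: adj_adj)

lemma norm_adj [simp]: "norm (adj a) = norm (a::'a::cstar_algebra)"
proof -
  have le: "norm b \<le> norm (adj b)" for b :: 'a
  proof (cases "b = 0")
    case False
    have "norm b * norm b \<le> norm (adj b) * norm b"
      using norm_mult_ineq[of "adj b" b] by (simp add: cstar_identity power2_eq_square)
    with False show ?thesis by simp
  qed simp
  show ?thesis using le[of a] le[of "adj a"] by (simp add: adj_adj)
qed

lemma adj_power: "adj (a ^ n) = adj (a::'a::{cstar_algebra, real_normed_algebra_1}) ^ n"
  by (induction n) (simp_all add: adj_mult power_commutes)

lemma norm_power_self_adjoint:
  fixes a :: "'a::{cstar_algebra, real_normed_algebra_1}"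
  assumes "adj a = a"
  shows "norm (a ^ (2 ^ k)) = norm a ^ (2 ^ k)"
proof (induction k)
  case (Suc k)
  have "norm (a ^ (2 ^ Suc k)) = norm (adj (a ^ (2 ^ k)) * a ^ (2 ^ k))"
    using assms by (simp add: adj_power power_add[symmetric] mult_2)
  also have "\<dots> = (norm a ^ (2 ^ k))\<^sup>2"
    by (simp only: cstar_identity Suc)
  finally show ?case by (simp add: power_mult[symmetric] mult.commute)
qed simp

text \<open>
  The difference is the sum of the \<open>2\<^bsup>n\<^esup> - 1\<close> words in \<open>a\<close> and \<open>b\<close> other than \<open>a\<^bsup>n\<^esup>\<close>.
\<close>

lemma norm_add_power_diff_le:
  fixes a :: "'a::real_normed_algebra_1"
  assumes "norm a \<le> 1" "norm b \<le> 1"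
  shows "norm ((a + b) ^ n - a ^ n) \<le> 2 ^ n - 1"
proof (induction n)
  case (Suc n)
  have "(a + b) ^ Suc n - a ^ Suc n = (a + b) * ((a + b) ^ n - a ^ n) + b * a ^ n"
    by (simp add: algebra_simps)
  then have "norm ((a + b) ^ Suc n - a ^ Suc n) \<le> norm (a + b) * norm ((a + b) ^ n - a ^ n) + norm b * norm (a ^ n)"
    by (metis norm_triangle_mono norm_mult_ineq)
  also have "norm (a ^ n) \<le> 1"
    using assms(1) norm_power_ineq[of a n] power_le_one[of "norm a" n] by simp
  then have "norm b * norm (a ^ n) \<le> 1"
    using assms(2) by (simp add: mult_le_one)
  moreover have "norm (a + b) \<le> 2"
    using assms norm_triangle_ineq[of a b] by simp
  then have "norm (a + b) * norm ((a + b) ^ n - a ^ n) \<le> 2 * (2 ^ n - 1)"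
    using Suc by (intro mult_mono) auto
  ultimately show ?case by simp
qed simp

text \<open>
  After normalization the self-adjoint element \<open>b + b\<^sup>*\<close> has norm two, so its \<open>N\<close>-th power has norm
  \<open>2\<^bsup>N\<^esup>\<close>; the words other than \<open>b\<^bsup>N\<^esup>\<close> account for at most \<open>2\<^bsup>N\<^esup> - 1\<close> of it.
\<close>

lemma norm_power_if_norm_add_adj:
  fixes b :: "'a::{cstar_algebra, real_normed_algebra_1}"
  assumes "norm (b + adj b) = 2 * norm b"
  shows "norm (b ^ (2 ^ k)) = norm b ^ (2 ^ k)"
proof (cases "b = 0")
  case False
  define a where "a = (1 / norm b) *\<^sub>R b"
  have adj_a: "adj a = (1 / norm b) *\<^sub>R adj b"
    by (simp add: a_def adj_scaleR)
  have na: "norm a = 1" using False by (simp add: a_def)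
  have "a + adj a = (1 / norm b) *\<^sub>R (b + adj b)"
    unfolding adj_a by (simp add: a_def scaleR_add_right)
  then have "norm (a + adj a) = 2" using False assms by simp
  moreover have "adj (a + adj a) = a + adj a" by (simp add: adj_add adj_adj add.commute)
  ultimately have "norm ((a + adj a) ^ (2 ^ k)) = 2 ^ (2 ^ k)"
    by (metis norm_power_self_adjoint)
  moreover have "norm ((a + adj a) ^ (2 ^ k) - a ^ (2 ^ k)) \<le> 2 ^ (2 ^ k) - 1"
    using na by (intro norm_add_power_diff_le) auto
  ultimately have "1 \<le> norm (a ^ (2 ^ k))"
    using norm_triangle_sub[of "(a + adj a) ^ (2 ^ k)" "a ^ (2 ^ k)"] by linarith
  moreover have "norm (a ^ (2 ^ k)) \<le> 1"
    using norm_power_ineq[of a "2 ^ k"] na by simp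
  ultimately have "norm (a ^ (2 ^ k)) = 1" by simp
  then show ?thesis using False by (simp add: a_def power_divide field_simps)
qed (simp add: zero_power)

text \<open>
  A shift by \<open>is\<close> moves a spectral value \<open>z\<close> to \<open>z + is\<close>, while the norm of \<open>a + is\<close> squared is at most
  \<open>\<parallel>a\<parallel>\<^sup>2 + s\<^sup>2\<close>. If \<open>z\<close> had a nonzero imaginary part, the term of \<open>|z + is|\<^sup>2\<close> linear in \<open>s\<close> would
  eventually exceed this bound.
\<close>

lemma unital_spectrum_self_adjoint_real:
  fixes a :: "'a::{cstar_algebra, real_normed_algebra_1}"
  assumes "adj a = a" "z \<in> unital_spectrum a"
  shows "Im z = 0"
proof (rule ccontr)
  assume nz: "Im z \<noteq> 0"
  have bound: "(Re z)\<^sup>2 + (Im z + s)\<^sup>2 \<le> (norm a)\<^sup>2 + s\<^sup>2" for s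
  proof -
    define b where "b = a + (\<i> * s) *\<^sub>C 1"
    have "z + \<i> * s \<in> unital_spectrum b"
      using assms(2) unital_spectrum_shift[of "z + \<i> * s" a "\<i> * s"] by (simp add: b_def)
    then have "(cmod (z + \<i> * s))\<^sup>2 \<le> (norm b)\<^sup>2"
      by (intro power_mono unital_spectrum_norm_le) auto
    also have "(norm b)\<^sup>2 = norm (adj b * b)" by (simp add: cstar_identity)
    also have "adj b * b = a * a + (s\<^sup>2) *\<^sub>C 1"
      using assms(1) by (simp add: b_def adj_add adj_scaleC algebra_simps scaleC_mult_left
          scaleC_mult_right scaleC_scaleC scaleC_minus_left scaleC_diff_right
          power2_eq_square)
    also have "norm \<dots> \<le> norm (a * a) + norm ((of_real (s\<^sup>2)) *\<^sub>C (1::'a))"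
      using norm_triangle_ineq by blast
    also have "\<dots> \<le> (norm a)\<^sup>2 + s\<^sup>2"
      using norm_mult_ineq[of a a] by (simp add: norm_scaleC power2_eq_square norm_mult)
    finally show ?thesis by (simp add: cmod_power2)
  qed
  define s where "s = ((norm a)\<^sup>2 + 1) / (2 * Im z)"
  have "2 * Im z * s = (norm a)\<^sup>2 + 1" using nz by (simp add: s_def)
  moreover have "2 * Im z * s \<le> (norm a)\<^sup>2"
    using bound[of s] by (simp add: power2_sum) (smt (verit) zero_le_power2)
  ultimately show False by simp
qed

lemma unital_spectrum_square:
  fixes a :: "'a::{complex_normed_algebra, real_normed_algebra_1}"
  assumes "z \<in> unital_spectrum a"
  shows "z\<^sup>2 \<in> unital_spectrum (a\<^sup>2)"
  unfolding unital_spectrum_def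
proof (rule CollectI, rule notI)
  assume "\<exists>v. is_inverse (a\<^sup>2 - z\<^sup>2 *\<^sub>C 1) v"
  then obtain v where v: "(a\<^sup>2 - z\<^sup>2 *\<^sub>C 1) * v = 1" "v * (a\<^sup>2 - z\<^sup>2 *\<^sub>C 1) = 1"
    by (auto simp: is_inverse_def)
  define p q where "p = a - z *\<^sub>C 1" and "q = a + z *\<^sub>C 1"
  have "a\<^sup>2 - z\<^sup>2 *\<^sub>C 1 = p * q" "a\<^sup>2 - z\<^sup>2 *\<^sub>C 1 = q * p"
    by (simp_all add: p_def q_def algebra_simps scaleC_add_right scaleC_diff_right scaleC_mult_left scaleC_mult_right scaleC_scaleC
        power2_eq_square)
  with v have "p * (q * v) = 1" "(v * q) * p = 1" by (simp_all add: mult.assoc)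
  then have "is_inverse p (q * v)"
    unfolding is_inverse_def by (metis mult.assoc mult.left_neutral mult.right_neutral)
  with assms show False by (auto simp: unital_spectrum_def p_def)
qed

lemma unital_spectrum_power:
  fixes a :: "'a::{complex_normed_algebra, real_normed_algebra_1}"
  assumes "z \<in> unital_spectrum a"
  shows "z ^ (2 ^ k) \<in> unital_spectrum (a ^ (2 ^ k))"
proof (induction k)
  case (Suc k)
  then show ?case
    using unital_spectrum_square[OF Suc] by (simp add: power_mult[symmetric] mult.commute)
qed (use assms in simp)

lemma unital_spectrum_scale:
  fixes a :: "'a::{complex_normed_algebra, real_normed_algebra_1}"
  assumes "z \<in> unital_spectrum a"
  shows "c * z \<in> unital_spectrum (c *\<^sub>C a)"
proof (cases "c = 0")
  case True
  then show ?thesis by (simp add: unital_spectrum_def is_inverse_def)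
next
  case False
  show ?thesis
    unfolding unital_spectrum_def
  proof (rule CollectI, rule notI)
    assume "\<exists>v. is_inverse (c *\<^sub>C a - (c * z) *\<^sub>C 1) v"
    then obtain v where "is_inverse (c *\<^sub>C a - (c * z) *\<^sub>C 1) v" ..
    from is_inverse_scaleC[OF this, of "inverse c"] False assms show False
      by (auto simp: unital_spectrum_def scaleC_diff_right scaleC_scaleC mult.assoc[symmetric])
  qed
qed

text \<open>
  A spectral value of \<open>u\<close> of modulus \<open>\<parallel>u\<parallel>\<close> is real, so its square is \<open>\<parallel>u\<parallel>\<^sup>2\<close> and lies in the spectrum
  of \<open>u\<^sup>2\<close>.
\<close>

lemma norm_add_square_ge:
  fixes u :: "'a::{cstar_algebra, real_normed_algebra_1}"
  assumes "adj u = u" "0 \<le> N"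
  shows "N + (norm u)\<^sup>2 \<le> norm (complex_of_real N *\<^sub>C 1 + u\<^sup>2)"
proof -
  obtain z where z: "z \<in> unital_spectrum u" "cmod z = norm u"
    using exists_spectral_value norm_power_self_adjoint[OF assms(1)] by blast
  have "z = of_real (Re z)"
    using unital_spectrum_self_adjoint_real[OF assms(1) z(1)] by (simp add: complex_eq_iff)
  then have z2: "z\<^sup>2 = of_real ((norm u)\<^sup>2)"
    by (metis z(2) norm_of_real of_real_power power2_abs)
  have "z\<^sup>2 + of_real N \<in> unital_spectrum (u\<^sup>2 + of_real N *\<^sub>C 1)"
    using unital_spectrum_square[OF z(1)] by (simp add: unital_spectrum_shift)
  then have "cmod (z\<^sup>2 + of_real N) \<le> norm (u\<^sup>2 + of_real N *\<^sub>C 1)"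
    by (rule unital_spectrum_norm_le)
  also have "z\<^sup>2 + of_real N = of_real (N + (norm u)\<^sup>2)" using z2 by simp
  finally show ?thesis using assms(2) by (simp add: add.commute del: of_real_add)
qed

text \<open>
  With \<open>c = b + N\<close>, the spectral value gives \<open>\<parallel>c\<parallel> \<ge> \<parallel>b\<parallel> + N\<close>, and \<open>c\<^sup>*c = b\<^sup>*b + N (N + b + b\<^sup>*)\<close> gives
  \<open>\<parallel>c\<parallel>\<^sup>2 \<le> \<parallel>b\<parallel>\<^sup>2 + N \<parallel>N + b + b\<^sup>*\<parallel>\<close>. The claim is what remains after cancelling.
\<close>

lemma norm_add_real_part_ge:
  fixes b :: "'a::{cstar_algebra, real_normed_algebra_1}"
  assumes "complex_of_real (norm b) \<in> unital_spectrum b" "0 < N"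
  shows "N + 2 * norm b \<le> norm (complex_of_real N *\<^sub>C 1 + (b + adj b))"
proof -
  define c where "c = b + of_real N *\<^sub>C 1"
  define h where "h = complex_of_real N *\<^sub>C 1 + (b + adj b)"
  have "complex_of_real (norm b) + of_real N \<in> unital_spectrum c"
    using assms(1) by (simp add: c_def unital_spectrum_shift)
  then have "cmod (complex_of_real (norm b) + of_real N) \<le> norm c"
    by (rule unital_spectrum_norm_le)
  then have "norm b + N \<le> norm c"
    using assms(2) by (metis abs_of_nonneg add_nonneg_nonneg less_imp_le norm_ge_zero norm_of_real of_real_add)
  then have "(norm b + N)\<^sup>2 \<le> (norm c)\<^sup>2"
    using assms(2) by (intro power_mono) auto
  also have "\<dots> = norm (adj c * c)" by (simp add: cstar_identity)
  also have "adj c * c = adj b * b + of_real N *\<^sub>C h"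
    by (simp add: c_def h_def adj_add adj_scaleC algebra_simps scaleC_add_right scaleC_mult_left
        scaleC_mult_right scaleC_scaleC)
  also have "norm \<dots> \<le> norm (adj b * b) + norm (complex_of_real N *\<^sub>C h)"
    by (rule norm_triangle_ineq)
  also have "\<dots> = (norm b)\<^sup>2 + N * norm h"
    using assms(2) by (simp add: cstar_identity norm_scaleC)
  finally have "N * (N + 2 * norm b) \<le> N * norm h"
    by (simp add: power2_eq_square algebra_simps)
  then show ?thesis using assms(2) by (simp add: h_def)
qed

text \<open>
  The norm of the self-adjoint element \<open>N - w\<close> is the modulus of one of its spectral values, and these
  lie in \<open>[0, N]\<close>.
\<close>

lemma norm_real_minus_le:
  fixes w :: "'a::{cstar_algebra, real_normed_algebra_1}"
  assumes "adj w = w" "unital_spectrum w \<subseteq> \<real>\<^sub>\<ge>\<^sub>0" "norm w \<le> N"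
  shows "norm (complex_of_real N *\<^sub>C 1 - w) \<le> N"
proof -
  define t where "t = w + (- of_real N) *\<^sub>C 1"
  have nt: "norm t = norm (complex_of_real N *\<^sub>C 1 - w)"
    by (simp add: t_def scaleC_minus_left norm_minus_commute)
  have "adj t = t" using assms(1) by (simp add: t_def adj_add adj_scaleC)
  then obtain z where z: "z \<in> unital_spectrum t" "cmod z = norm t"
    using exists_spectral_value norm_power_self_adjoint by blast
  then have zN: "z + of_real N \<in> unital_spectrum w"
    using unital_spectrum_shift[of z w "- of_real N"] by (simp add: t_def)
  then obtain r where r: "z + of_real N = of_real r" "r \<ge> 0"
    using assms(2) by (auto elim!: nonneg_Reals_cases)
  have "r \<le> N"
    using unital_spectrum_norm_le[OF zN] r assms(3) by simp
  moreover have "z = of_real (r - N)" using r by (simp add: algebra_simps)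
  ultimately have "cmod z \<le> N" using r by (simp del: of_real_diff)
  with z nt show ?thesis by simp
qed

section \<open>The unitization as a C*-algebra\<close>

datatype 'a unitization = Unitization (alg_part: 'a) (scalar_part: complex)

lemma unitization_eq_iff: "u = v \<longleftrightarrow> alg_part u = alg_part v \<and> scalar_part u = scalar_part v"
  by (cases u; cases v) simp

text \<open>
  The unitization acts on the ideal \<open>A\<close> by left multiplication. The operator norm of this action
  satisfies the C*-identity, but it is only a seminorm when \<open>A\<close> already has a unit; taking the maximum
  with the modulus of the scalar part repairs this and keeps the C*-identity.
\<close>

definition left_mult :: "'a::complex_normed_algebra unitization \<Rightarrow> 'a \<Rightarrow> 'a" where
  "left_mult u b = alg_part u * b + scalar_part u *\<^sub>C b"

instantiation unitization :: (cstar_algebra) complex_vector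
begin

definition "0 = Unitization 0 0"
definition "u + v = Unitization (alg_part u + alg_part v) (scalar_part u + scalar_part v)"
definition "- u = Unitization (- alg_part u) (- scalar_part u)"
definition "u - v = Unitization (alg_part u - alg_part v) (scalar_part u - scalar_part v)"
definition "scaleR r u = Unitization (r *\<^sub>R alg_part u) (r *\<^sub>R scalar_part u)"
definition "scaleC c u = Unitization (c *\<^sub>C alg_part u) (c * scalar_part u)"

instance
  by standard (simp_all add: zero_unitization_def plus_unitization_def uminus_unitization_def
      minus_unitization_def scaleR_unitization_def scaleC_unitization_def unitization_eq_iff
      algebra_simps scaleC_add_right scaleC_add_left scaleC_scaleC
      scaleR_scaleC[where 'a = 'a] scaleR_conv_of_real)

end

lemma unitization_linear_parts [simp]:
  "alg_part 0 = 0" "scalar_part 0 = 0"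
  "alg_part (u + v) = alg_part u + alg_part v" "scalar_part (u + v) = scalar_part u + scalar_part v"
  "alg_part (- u) = - alg_part u" "scalar_part (- u) = - scalar_part u"
  "alg_part (u - v) = alg_part u - alg_part v" "scalar_part (u - v) = scalar_part u - scalar_part v"
  "alg_part (r *\<^sub>R u) = r *\<^sub>R alg_part u" "scalar_part (r *\<^sub>R u) = r *\<^sub>R scalar_part u"
  "alg_part (c *\<^sub>C u) = c *\<^sub>C alg_part u" "scalar_part (c *\<^sub>C u) = c * scalar_part u"
  by (simp_all add: zero_unitization_def plus_unitization_def uminus_unitization_def
      minus_unitization_def scaleR_unitization_def scaleC_unitization_def)

lemma bounded_linear_scaleC:
  "bounded_linear (\<lambda>x::'a::complex_normed_vector. c *\<^sub>C x)"
proof (rule bounded_linear_intro[where K = "cmod c"])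
  show "c *\<^sub>C (r *\<^sub>R x) = r *\<^sub>R (c *\<^sub>C x)" for r and x :: 'a
    by (simp only: scaleR_scaleC scaleC_scaleC mult.commute)
qed (simp_all add: scaleC_add_right norm_scaleC mult.commute)

lemma bounded_linear_left_mult: "bounded_linear (left_mult u)"
  unfolding left_mult_def
  by (intro bounded_linear_add bounded_linear_mult_right bounded_linear_scaleC)

lemma left_mult_add: "left_mult (u + v) b = left_mult u b + left_mult v b"
  by (simp add: left_mult_def algebra_simps scaleC_add_left)

lemma left_mult_scaleC: "left_mult (c *\<^sub>C u) b = c *\<^sub>C left_mult u b"
  by (simp add: left_mult_def scaleC_add_right scaleC_mult_left scaleC_scaleC)

text \<open>
  The lower bound comes from letting \<open>a\<close> act on \<open>a\<^sup>*\<close>, because \<open>\<parallel>a a\<^sup>*\<parallel> = \<parallel>a\<parallel>\<^sup>2\<close>.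
\<close>

lemma onorm_left_mult_alg:
  assumes "scalar_part u = 0"
  shows "onorm (left_mult u) = norm (alg_part u :: 'a::cstar_algebra)"
proof (rule antisym)
  show "onorm (left_mult u) \<le> norm (alg_part u)"
    using assms by (intro onorm_bound) (auto simp: left_mult_def norm_mult_ineq)
  have "norm (adj (adj (alg_part u)) * adj (alg_part u)) \<le> onorm (left_mult u) * norm (adj (alg_part u))"
    using onorm[OF bounded_linear_left_mult, of u "adj (alg_part u)"] assms
    by (simp add: left_mult_def adj_adj)
  then have "norm (alg_part u) * norm (alg_part u) \<le> onorm (left_mult u) * norm (alg_part u)"
    unfolding cstar_identity norm_adj by (simp add: power2_eq_square)
  then show "norm (alg_part u) \<le> onorm (left_mult u)"
    using onorm_pos_le[OF bounded_linear_left_mult, of u] by (cases "alg_part u = 0") auto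
qed

lemma onorm_left_mult_scaleC: "onorm (left_mult (c *\<^sub>C u)) = cmod c * onorm (left_mult u)"
proof (rule antisym)
  have le: "onorm (left_mult (c *\<^sub>C u)) \<le> cmod c * onorm (left_mult u)" for c and u :: "'a unitization"
  proof (rule onorm_bound)
    show "norm (left_mult (c *\<^sub>C u) b) \<le> cmod c * onorm (left_mult u) * norm b" for b
      using onorm[OF bounded_linear_left_mult, of u b]
      by (simp add: left_mult_scaleC norm_scaleC mult.assoc mult_left_mono)
  qed (simp add: onorm_pos_le bounded_linear_left_mult)
  then show "onorm (left_mult (c *\<^sub>C u)) \<le> cmod c * onorm (left_mult u)" .
  show "cmod c * onorm (left_mult u) \<le> onorm (left_mult (c *\<^sub>C u))"
  proof (cases "c = 0")
    case False
    then have "cmod c * onorm (left_mult u) \<le> cmod c * (cmod (inverse c) * onorm (left_mult (c *\<^sub>C u)))"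
      using le[of "inverse c" "c *\<^sub>C u"] by (intro mult_left_mono) (auto simp: scaleC_scaleC)
    with False show ?thesis by (simp add: mult.assoc[symmetric] norm_mult[symmetric])
  qed (simp add: onorm_pos_le bounded_linear_left_mult)
qed

lemma scaleC_of_real_eq_scaleR: "complex_of_real r *\<^sub>C x = r *\<^sub>R x"
  by (simp add: scaleR_scaleC)

instantiation unitization :: (cstar_algebra) complex_normed_vector
begin

definition "norm u = max (cmod (scalar_part u)) (onorm (left_mult u))"
definition "dist u v = norm (u - v :: 'a unitization)"
definition "sgn u = u /\<^sub>R norm (u :: 'a unitization)"
definition [code del]: "(uniformity :: ('a unitization \<times> 'a unitization) filter) =
  (INF e\<in>{0 <..}. principal {(x, y). dist x y < e})"
definition [code del]: "open (U :: 'a unitization set) \<longleftrightarrow>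
  (\<forall>x\<in>U. \<forall>\<^sub>F (x', y) in uniformity. x' = x \<longrightarrow> y \<in> U)"

instance
proof
  fix u v :: "'a unitization" and r :: real and c :: complex
  show "norm u = 0 \<longleftrightarrow> u = 0"
  proof
    assume n: "norm u = 0"
    have "onorm (left_mult u) \<ge> 0" by (simp add: onorm_pos_le bounded_linear_left_mult)
    with n have "scalar_part u = 0" "onorm (left_mult u) = 0"
      unfolding norm_unitization_def by (smt (verit) norm_ge_zero norm_eq_zero)+
    then show "u = 0" using onorm_left_mult_alg[of u] by (simp add: unitization_eq_iff)
  next
    show "u = 0 \<Longrightarrow> norm u = 0"
      by (simp add: norm_unitization_def onorm_left_mult_alg)
  qed
  have "onorm (left_mult (u + v)) \<le> onorm (left_mult u) + onorm (left_mult v)"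
    using onorm_triangle[OF bounded_linear_left_mult[of u] bounded_linear_left_mult[of v]]
    by (simp add: left_mult_add[abs_def])
  then show "norm (u + v) \<le> norm u + norm v"
    using norm_triangle_ineq[of "scalar_part u" "scalar_part v"]
    unfolding norm_unitization_def unitization_linear_parts by linarith
  show nc: "norm (c *\<^sub>C u) = cmod c * norm u" for c
    by (simp add: norm_unitization_def onorm_left_mult_scaleC norm_mult max_mult_distrib_left)
  show "norm (r *\<^sub>R u) = \<bar>r\<bar> * norm u"
    using nc[of "of_real r"] by (simp add: scaleC_of_real_eq_scaleR)
qed (simp_all add: dist_unitization_def sgn_unitization_def uniformity_unitization_def
    open_unitization_def)

end

instantiation unitization :: (cstar_algebra) "{complex_normed_algebra, real_normed_algebra_1}"
begin

definition "1 = Unitization 0 1"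
definition "u * v = Unitization
  (alg_part u * alg_part v + scalar_part u *\<^sub>C alg_part v + scalar_part v *\<^sub>C alg_part u)
  (scalar_part u * scalar_part v)"

lemma left_mult_times: "left_mult (u * v) b = left_mult u (left_mult v (b::'a))"
  by (simp add: left_mult_def times_unitization_def algebra_simps scaleC_add_right scaleC_add_left
      scaleC_mult_left scaleC_mult_right scaleC_scaleC)

lemma scaleR_mult_scaleC:
  "r *\<^sub>R (c *\<^sub>C x) = (of_real r * c) *\<^sub>C (x::'a)" "c *\<^sub>C (r *\<^sub>R x) = (of_real r * c) *\<^sub>C (x::'a)"
  by (simp_all add: scaleR_scaleC scaleC_scaleC mult.commute)

instance
proof
  fix u v w :: "'a unitization" and r :: real and c :: complex
  show "u * v * w = u * (v * w)" "(u + v) * w = u * w + v * w" "u * (v + w) = u * v + u * w"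
      "1 * u = u" "u * 1 = u" "(0::'a unitization) \<noteq> 1"
      "c *\<^sub>C u * v = c *\<^sub>C (u * v)" "u * c *\<^sub>C v = c *\<^sub>C (u * v)"
    by (simp_all add: times_unitization_def one_unitization_def unitization_eq_iff algebra_simps
      scaleC_add_right scaleC_add_left scaleC_mult_left scaleC_mult_right scaleC_scaleC)
  show "r *\<^sub>R u * v = r *\<^sub>R (u * v)" "u * r *\<^sub>R v = r *\<^sub>R (u * v)"
    by (simp_all add: times_unitization_def unitization_eq_iff algebra_simps
      scaleC_add_right scaleC_add_left scaleR_mult_scaleC scaleR_conv_of_real[where 'a = complex])
  have "onorm (left_mult (u * v)) \<le> onorm (left_mult u) * onorm (left_mult v)"
    using onorm_compose[OF bounded_linear_left_mult[of u] bounded_linear_left_mult[of v]]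
    by (simp add: left_mult_times[abs_def] o_def)
  moreover have "onorm (left_mult u) * onorm (left_mult v) \<le> norm u * norm v"
    by (intro mult_mono) (auto simp: norm_unitization_def onorm_pos_le bounded_linear_left_mult
        intro: le_max_iff_disj[THEN iffD2])
  moreover have "cmod (scalar_part (u * v)) \<le> norm u * norm v"
    by (auto simp: norm_unitization_def times_unitization_def norm_mult intro!: mult_mono
        intro: le_max_iff_disj[THEN iffD2])
  ultimately show "norm (u * v) \<le> norm u * norm v"
    unfolding norm_unitization_def[of "u * v"] by simp
  have "onorm (left_mult (1::'a unitization)) \<le> 1"
    by (intro onorm_bound) (auto simp: left_mult_def one_unitization_def)
  then show "norm (1::'a unitization) = 1"
    by (simp add: norm_unitization_def one_unitization_def)
qed

end

lemma norm_unitization_scalar_le: "cmod (scalar_part u) \<le> norm u"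
  by (simp add: norm_unitization_def)

lemma norm_Unitization_0 [simp]: "norm (Unitization a 0) = norm a"
  using onorm_left_mult_alg[of "Unitization a 0"] by (simp add: norm_unitization_def)

lemma unitization_decomp: "u = Unitization (alg_part u) 0 + scalar_part u *\<^sub>C 1"
  by (simp add: unitization_eq_iff one_unitization_def)

lemma norm_unitization_alg_le: "norm (alg_part u) \<le> 2 * norm u"
proof -
  have "Unitization (alg_part u) 0 = u - scalar_part u *\<^sub>C 1"
    by (simp add: unitization_eq_iff one_unitization_def)
  then have "norm (alg_part u) = norm (u - scalar_part u *\<^sub>C 1)"
    by (metis norm_Unitization_0)
  also have "\<dots> \<le> norm u + cmod (scalar_part u)"
    using norm_triangle_ineq4[of u "scalar_part u *\<^sub>C 1"] by (simp add: norm_scaleC)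
  finally show ?thesis using norm_unitization_scalar_le[of u] by simp
qed

lemma norm_unitization_le: "norm u \<le> norm (alg_part u) + cmod (scalar_part u)"
proof -
  have "norm u \<le> norm (Unitization (alg_part u) 0) + norm (scalar_part u *\<^sub>C (1::'a unitization))"
    by (subst unitization_decomp) (rule norm_triangle_ineq)
  then show ?thesis by (simp add: norm_scaleC)
qed

instance unitization :: (cstar_algebra) banach
proof
  fix X :: "nat \<Rightarrow> 'a unitization"
  assume X: "Cauchy X"
  have "Cauchy (\<lambda>n. alg_part (X n))"
  proof (rule metric_CauchyI)
    fix e :: real assume "e > 0"
    then obtain M where M: "\<forall>m\<ge>M. \<forall>n\<ge>M. dist (X m) (X n) < e / 2"
      using X metric_CauchyD[of X "e / 2"] by auto
    have "dist (alg_part (X m)) (alg_part (X n)) < e" if "m \<ge> M" "n \<ge> M" for m n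
      using M that norm_unitization_alg_le[of "X m - X n"] by (fastforce simp: dist_norm)
    then show "\<exists>M. \<forall>m\<ge>M. \<forall>n\<ge>M. dist (alg_part (X m)) (alg_part (X n)) < e" by blast
  qed
  then obtain a where a: "(\<lambda>n. alg_part (X n)) \<longlonglongrightarrow> a"
    using Cauchy_convergent convergent_def by blast
  have "Cauchy (\<lambda>n. scalar_part (X n))"
  proof (rule metric_CauchyI)
    fix e :: real assume "e > 0"
    then obtain M where M: "\<forall>m\<ge>M. \<forall>n\<ge>M. dist (X m) (X n) < e"
      using X metric_CauchyD[of X e] by auto
    have "dist (scalar_part (X m)) (scalar_part (X n)) < e" if "m \<ge> M" "n \<ge> M" for m n
      using M that norm_unitization_scalar_le[of "X m - X n"] by (fastforce simp: dist_norm)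
    then show "\<exists>M. \<forall>m\<ge>M. \<forall>n\<ge>M. dist (scalar_part (X m)) (scalar_part (X n)) < e" by blast
  qed
  then obtain z where z: "(\<lambda>n. scalar_part (X n)) \<longlonglongrightarrow> z"
    using Cauchy_convergent convergent_def by blast
  have lim: "(\<lambda>n. norm (alg_part (X n) - a) + cmod (scalar_part (X n) - z)) \<longlonglongrightarrow> 0"
    using tendsto_add[OF tendsto_norm_zero[OF LIM_zero[OF a]] tendsto_norm_zero[OF LIM_zero[OF z]]]
    by simp
  have "norm (X n - Unitization a z) \<le> norm (alg_part (X n) - a) + cmod (scalar_part (X n) - z)" for n
    using norm_unitization_le[of "X n - Unitization a z"] by simp
  then have "(\<lambda>n. X n - Unitization a z) \<longlonglongrightarrow> 0"
    by (intro Lim_null_comparison[OF _ lim] always_eventually allI)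
  then have "X \<longlonglongrightarrow> Unitization a z"
    by (rule LIM_zero_cancel)
  then show "convergent X" by (auto simp: convergent_def)
qed

instantiation unitization :: (cstar_algebra) cstar_algebra
begin

definition "adj u = Unitization (adj (alg_part u)) (cnj (scalar_part u))"

text \<open>
  For \<open>b\<close> in \<open>A\<close> the C*-identity of \<open>A\<close> gives
  \<open>\<parallel>u b\<parallel>\<^sup>2 = \<parallel>b\<^sup>* (u\<^sup>* u b)\<parallel> \<le> \<parallel>u\<^sup>* u\<parallel> \<parallel>b\<parallel>\<^sup>2\<close>; the other inequality is then a consequence of
  submultiplicativity.
\<close>

lemma onorm_left_mult_cstar:
  "(onorm (left_mult u))\<^sup>2 = onorm (left_mult (adj u * u :: 'a unitization))"
proof -
  let ?p = "\<lambda>u :: 'a unitization. onorm (left_mult u)"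
  have pos: "?p u \<ge> 0" for u by (simp add: onorm_pos_le bounded_linear_left_mult)
  have ge: "(?p u)\<^sup>2 \<le> ?p (adj u * u)" for u
  proof -
    have "norm (left_mult u b) \<le> sqrt (?p (adj u * u)) * norm b" for b
    proof -
      have "(norm (left_mult u b))\<^sup>2 = norm (adj b * left_mult (adj u * u) b)"
        unfolding cstar_identity[symmetric]
        by (simp add: left_mult_times) (simp add: left_mult_def adj_unitization_def adj_add adj_mult
            adj_scaleC algebra_simps scaleC_mult_left scaleC_mult_right scaleC_add_right
            scaleC_scaleC)
      also have "\<dots> \<le> norm (adj b) * norm (left_mult (adj u * u) b)"
        by (rule norm_mult_ineq)
      also have "\<dots> \<le> norm b * (?p (adj u * u) * norm b)"
        unfolding norm_adj by (intro mult_left_mono onorm[OF bounded_linear_left_mult]) simp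
      also have "\<dots> = (sqrt (?p (adj u * u)) * norm b)\<^sup>2"
        using pos by (simp add: power_mult_distrib power2_eq_square)
      finally show ?thesis by (rule power2_le_imp_le) (simp add: pos)
    qed
    then have "?p u \<le> sqrt (?p (adj u * u))" by (intro onorm_bound) (auto simp: pos)
    then show ?thesis using pos power_mono[of "?p u" "sqrt (?p (adj u * u))" 2] by simp
  qed
  have mult: "?p (u * v) \<le> ?p u * ?p v" for u v
    using onorm_compose[OF bounded_linear_left_mult[of u] bounded_linear_left_mult[of v]]
    by (simp add: left_mult_times[abs_def] o_def)
  have le: "?p u \<le> ?p (adj u)" for u
  proof (cases "?p u = 0")
    case False
    have "?p u * ?p u \<le> ?p (adj u) * ?p u"
      using ge[of u] mult[of "adj u" u] by (simp add: power2_eq_square)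
    then show ?thesis using False pos[of u] by simp
  qed (simp add: pos)
  have "?p (adj u) \<le> ?p u"
    using le[of "adj u"] by (simp add: adj_unitization_def adj_adj)
  then have "?p (adj u * u) \<le> ?p u * ?p u"
    using mult[of "adj u" u] pos[of u] by (meson mult_right_mono order_trans)
  with ge[of u] show ?thesis by (simp add: power2_eq_square)
qed

instance
proof
  fix u v :: "'a unitization" and c :: complex
  show "adj (adj u) = u" "adj (u + v) = adj u + adj v" "adj (c *\<^sub>C u) = cnj c *\<^sub>C adj u"
      "adj (u * v) = adj v * adj u"
    by (simp_all add: adj_unitization_def times_unitization_def unitization_eq_iff adj_adj adj_add
        adj_scaleC adj_mult algebra_simps)
  have "cmod (scalar_part (adj u * u)) = (cmod (scalar_part u))\<^sup>2"
    by (simp add: adj_unitization_def times_unitization_def norm_mult power2_eq_square)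
  moreover have "max (a\<^sup>2) (b\<^sup>2) = (max a b)\<^sup>2" if "a \<ge> 0" "b \<ge> 0" for a b :: real
    using that by (auto simp: max_def intro: antisym power_mono dest: power2_le_imp_le)
  ultimately show "norm (adj u * u) = (norm u)\<^sup>2"
    by (simp add: norm_unitization_def onorm_left_mult_cstar[symmetric] onorm_pos_le
        bounded_linear_left_mult)
qed

end

abbreviation unitize :: "'a::cstar_algebra \<Rightarrow> 'a unitization" where
  "unitize a \<equiv> Unitization a 0"

lemma unitize_hom:
  "unitize (a + b) = unitize a + unitize b" "unitize (a - b) = unitize a - unitize b"
  "unitize (a * b) = unitize a * unitize b" "unitize (c *\<^sub>C a) = c *\<^sub>C unitize a"
  "unitize (adj a) = adj (unitize a)"
  by (simp_all add: unitization_eq_iff times_unitization_def adj_unitization_def)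

lemma spectrum_eq_unital_spectrum: "spectrum a = unital_spectrum (unitize a)"
proof -
  have iff: "unitization_invertible (a, - z) \<longleftrightarrow> (\<exists>b. is_inverse (unitize a - z *\<^sub>C 1) b)" (is "?L \<longleftrightarrow> ?R") for z
  proof
    assume ?L
    then obtain v where "unitization_mult (a, - z) v = (0, 1)" "unitization_mult v (a, - z) = (0, 1)"
      by (auto simp: unitization_invertible_def)
    then have "is_inverse (unitize a - z *\<^sub>C 1) (Unitization (fst v) (snd v))"
      by (simp add: is_inverse_def unitization_mult_def times_unitization_def one_unitization_def
          unitization_eq_iff algebra_simps)
    then show ?R by blast
  next
    assume ?R
    then obtain v where "is_inverse (unitize a - z *\<^sub>C 1) v" ..
    then have "unitization_mult (a, - z) (alg_part v, scalar_part v) = (0, 1)"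
      "unitization_mult (alg_part v, scalar_part v) (a, - z) = (0, 1)"
      by (simp_all add: is_inverse_def unitization_mult_def times_unitization_def one_unitization_def
          unitization_eq_iff algebra_simps)
    then show ?L by (auto simp: unitization_invertible_def)
  qed
  show ?thesis by (simp add: spectrum_def unital_spectrum_def iff)
qed

section \<open>Spectral radius and positivity in non-unital C*-algebras\<close>

lemma cmod_le_norm_if_spectrum: "z \<in> spectrum a \<Longrightarrow> cmod z \<le> norm (a::'a::cstar_algebra)"
  using unital_spectrum_norm_le[of z "unitize a"] by (simp add: spectrum_eq_unital_spectrum)

lemma zero_in_spectrum: "0 \<in> spectrum (a::'a::cstar_algebra)"
  by (auto simp: spectrum_def unitization_invertible_def unitization_mult_def)

text \<open>
  If the supremum equals \<open>\<parallel>a\<parallel>\<close>, then, as \<open>|z|\<^bsup>N\<^esup> \<le> \<parallel>a\<^bsup>N\<^esup>\<parallel>\<close> for spectral values \<open>z\<close>, the norms of the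
  powers do not drop, and the supremum is attained by the criterion for spectral values of
  maximal modulus.
\<close>

lemma spectral_radius_eq_norm_iff:
  "spectral_radius a = norm (a::'a::cstar_algebra) \<longleftrightarrow>
    (\<exists>z\<in>unital_spectrum (unitize a). cmod z = norm a)"
proof
  assume r: "spectral_radius a = norm a"
  have "norm (unitize a ^ (2 ^ k)) = norm (unitize a) ^ (2 ^ k)" for k
  proof (rule antisym)
    let ?N = "2 ^ k :: nat"
    have "spectral_radius a \<le> root ?N (norm (unitize a ^ ?N))"
      unfolding spectral_radius_def
    proof (rule cSUP_least)
      show "spectrum a \<noteq> {}" using zero_in_spectrum by blast
      fix z assume "z \<in> spectrum a"
      then have "cmod (z ^ ?N) \<le> norm (unitize a ^ ?N)"
        by (intro unital_spectrum_norm_le unital_spectrum_power) (simp add: spectrum_eq_unital_spectrum)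
      then have "root ?N (cmod z ^ ?N) \<le> root ?N (norm (unitize a ^ ?N))"
        by (intro real_root_le_mono) (simp_all add: norm_power)
      then show "cmod z \<le> root ?N (norm (unitize a ^ ?N))"
        by (simp add: real_root_power_cancel)
    qed
    then show "norm (unitize a) ^ ?N \<le> norm (unitize a ^ ?N)"
      using r power_mono[of "norm a" "root ?N (norm (unitize a ^ ?N))" ?N] by simp
  qed (rule norm_power_ineq)
  then show "\<exists>z\<in>unital_spectrum (unitize a). cmod z = norm a"
    using exists_spectral_value[of "unitize a"] by simp
next
  assume "\<exists>z\<in>unital_spectrum (unitize a). cmod z = norm a"
  then obtain z where z: "z \<in> spectrum a" "cmod z = norm a"
    by (auto simp: spectrum_eq_unital_spectrum)
  show "spectral_radius a = norm a"
    unfolding spectral_radius_def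
  proof (rule antisym)
    show "(SUP z\<in>spectrum a. cmod z) \<le> norm a"
      using z(1) by (intro cSUP_least) (auto intro: cmod_le_norm_if_spectrum)
    show "norm a \<le> (SUP z\<in>spectrum a. cmod z)"
      unfolding z(2)[symmetric] using z(1)
      by (intro cSUP_upper bdd_aboveI2[where M = "norm a"]) (auto intro: cmod_le_norm_if_spectrum)
  qed
qed

text \<open>
  Positivity enters all later arguments only through this estimate, which follows from
  \<open>N + k = (N - w) + (w + k)\<close>.
\<close>

lemma norm_real_add_le_if_positive:
  fixes w k :: "'a::cstar_algebra"
  assumes "positive w" "norm w \<le> N"
  shows "norm (complex_of_real N *\<^sub>C 1 + unitize k) \<le> N + norm (w + k)"
proof -
  have "norm (complex_of_real N *\<^sub>C 1 - unitize w) \<le> N"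
    using assms by (intro norm_real_minus_le)
      (auto simp: positive_def spectrum_eq_unital_spectrum unitize_hom(5)[symmetric])
  then have "norm ((complex_of_real N *\<^sub>C 1 - unitize w) + unitize (w + k)) \<le> N + norm (w + k)"
    by (intro norm_triangle_le add_mono) simp_all
  then show ?thesis by (simp add: unitize_hom)
qed

text \<open>
  This is monotonicity of the norm for \<open>0 \<le> u\<^sup>2 \<le> w + u\<^sup>2\<close>: with \<open>r = \<parallel>w\<parallel>\<close>, the norm of \<open>r + u\<^sup>2\<close> is at
  least \<open>r + \<parallel>u\<parallel>\<^sup>2\<close> and at most \<open>r + \<parallel>w + u\<^sup>2\<parallel>\<close>.
\<close>

lemma norm_square_le_if_positive:
  fixes w u :: "'a::cstar_algebra"
  assumes "positive w" "adj u = u"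
  shows "(norm u)\<^sup>2 \<le> norm (w + u * u)"
proof -
  have "norm w + (norm (unitize u))\<^sup>2 \<le> norm (complex_of_real (norm w) *\<^sub>C 1 + (unitize u)\<^sup>2)"
    using assms(2) by (intro norm_add_square_ge) (auto simp: unitize_hom(5)[symmetric])
  also have "(unitize u)\<^sup>2 = unitize (u * u)" by (simp add: power2_eq_square unitize_hom)
  also have "norm (complex_of_real (norm w) *\<^sub>C 1 + unitize (u * u)) \<le> norm w + norm (w + u * u)"
    using assms(1) by (rule norm_real_add_le_if_positive) simp
  finally show ?thesis by simp
qed

section \<open>Parallelism in Hilbert modules\<close>

context hilbert_module
begin

abbreviation mnorm where "mnorm \<equiv> ip_norm ip"

lemma ip_add_left: "ip (x + y) z = ip x z + ip y z"
  by (metis adj_add adj_ip ip_add_right)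

lemma ip_scaleC_left: "ip (c *\<^sub>C x) y = cnj c *\<^sub>C ip x y"
  by (metis adj_ip adj_scaleC ip_scaleC_right)

lemma ip_act_left: "ip (act x a) y = adj a * ip x y"
  by (metis adj_ip adj_mult ip_act_right)

lemma ip_minus_right: "ip x (- y) = - ip x y"
  using ip_scaleC_right[of x "-1" y] by (simp add: scaleC_minus_left)

lemma ip_minus_left: "ip (- x) y = - ip x y"
  using ip_scaleC_left[of "-1" x y] by (simp add: scaleC_minus_left)

lemma ip_diff_right: "ip x (y - z) = ip x y - ip x z"
  using ip_add_right[of x y "- z"] by (simp add: ip_minus_right)

lemma ip_diff_left: "ip (x - y) z = ip x z - ip y z"
  using ip_add_left[of x "- y" z] by (simp add: ip_minus_left)

lemma mnorm_nonneg: "mnorm x \<ge> 0"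
  by (simp add: ip_norm_def)

lemma mnorm_square: "(mnorm x)\<^sup>2 = norm (ip x x)"
  by (simp add: ip_norm_def)

lemma mnorm_eq_zero_iff: "mnorm x = 0 \<longleftrightarrow> x = 0"
  by (simp add: ip_norm_def ip_eq_zero_iff)

lemma mnorm_scaleC: "mnorm (c *\<^sub>C x) = cmod c * mnorm x"
  by (simp add: ip_norm_def ip_scaleC_left ip_scaleC_right norm_scaleC real_sqrt_mult)

text \<open>
  With \<open>a = \<langle>x, y\<rangle>\<close> and \<open>u = a\<^sup>* a\<close>, the usual choice \<open>y - t x a\<close> would require positivity of
  \<open>a\<^sup>* a\<close>. Testing with \<open>y - t x a u\<close> instead produces the cross term \<open>2t u\<^sup>2\<close>, the square of a
  self-adjoint element, so that norm monotonicity for such squares suffices.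
\<close>

lemma cauchy_schwarz: "norm (ip x y) \<le> mnorm x * mnorm y"
proof (cases "ip x y = 0")
  case True
  then show ?thesis by (simp add: mnorm_nonneg)
next
  case False
  define a where "a = ip x y"
  define u where "u = adj a * a"
  have a0: "norm a > 0" using False by (simp add: a_def)
  have "x \<noteq> 0" using False ip_scaleC_left[of 0 0 y] by auto
  then have x0: "mnorm x > 0" using mnorm_nonneg[of x] mnorm_eq_zero_iff[of x] by simp
  \<comment> \<open>This value of \<open>t\<close> optimizes \<open>2t \<parallel>u\<parallel>\<^sup>2 \<le> \<parallel>y\<parallel>\<^sup>2 + t\<^sup>2 \<parallel>a\<parallel>\<^sup>2 \<parallel>u\<parallel>\<^sup>2 \<parallel>x\<parallel>\<^sup>2\<close>, where \<open>\<parallel>u\<parallel> = \<parallel>a\<parallel>\<^sup>2\<close>.\<close>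
  define t where "t = 1 / ((norm a)\<^sup>2 * (mnorm x)\<^sup>2)"
  have t: "t > 0" using a0 x0 by (simp add: t_def)
  define c where "c = complex_of_real t *\<^sub>C (a * u)"
  define w where "w = ip (y - act x c) (y - act x c)"
  have adj_u: "adj u = u" by (simp add: u_def adj_mult adj_adj)
  have nu: "norm u = (norm a)\<^sup>2" by (simp add: u_def cstar_identity)
  have yx: "ip y x = adj a" by (simp add: a_def adj_ip)
  have cross: "ip y (act x c) = t *\<^sub>R (u * u)"
    by (simp add: ip_act_right yx c_def u_def scaleR_scaleC scaleC_mult_right mult.assoc)
  then have cross': "ip (act x c) y = t *\<^sub>R (u * u)"
    by (metis adj_ip adj_mult adj_scaleR adj_u)
  define r where "r = sqrt (2 * t) *\<^sub>R u"
  have rr: "r * r = (2 * t) *\<^sub>R (u * u)" using t by (simp add: r_def)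
  have "w + r * r = ip y y + ip (act x c) (act x c)"
    by (simp add: w_def rr ip_diff_left ip_diff_right cross cross' scaleR_left_distrib[symmetric]
        algebra_simps)
  moreover have "(norm r)\<^sup>2 \<le> norm (w + r * r)"
    by (rule norm_square_le_if_positive) (simp_all add: w_def ip_positive r_def adj_scaleR adj_u)
  ultimately have "2 * t * (norm u)\<^sup>2 \<le> norm (ip y y + ip (act x c) (act x c))"
    using t by (simp add: r_def power_mult_distrib)
  also have "\<dots> \<le> (mnorm y)\<^sup>2 + norm (ip (act x c) (act x c))"
    using norm_triangle_ineq by (simp add: mnorm_square)
  also have "norm (ip (act x c) (act x c)) \<le> norm (adj c) * (norm (ip x x) * norm c)"
    unfolding ip_act_left ip_act_right mult.assoc
    by (meson mult_left_mono norm_ge_zero norm_mult_ineq order_trans)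
  also have "\<dots> = (norm c)\<^sup>2 * (mnorm x)\<^sup>2" 
    by (simp add: mnorm_square[symmetric] power2_eq_square)
  also have "\<dots> \<le> (t * (norm a * norm u))\<^sup>2 * (mnorm x)\<^sup>2"
    using t by (intro mult_right_mono power_mono) (auto simp: c_def norm_scaleC norm_mult_ineq)
  finally have "2 * t * (norm u)\<^sup>2 \<le> (mnorm y)\<^sup>2 + (t * (norm a * norm u))\<^sup>2 * (mnorm x)\<^sup>2"
    by simp
  then have "(norm a)\<^sup>2 \<le> (mnorm x * mnorm y)\<^sup>2"
    using a0 x0 unfolding nu t_def by (simp add: field_simps power2_eq_square)
  then show ?thesis
    unfolding a_def by (rule power2_le_imp_le) (simp add: mnorm_nonneg)
qed

lemma ip_add_self:
  "ip (x + c *\<^sub>C y) (x + c *\<^sub>C y) =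
    ip x x + (c *\<^sub>C ip x y + adj (c *\<^sub>C ip x y)) + (cmod c)\<^sup>2 *\<^sub>R ip y y"
proof -
  have "cnj c * c = complex_of_real ((cmod c)\<^sup>2)" 
    using complex_norm_square[of c] by (simp add: mult.commute)
  then show ?thesis
    by (simp add: ip_add_left ip_add_right ip_scaleC_left ip_scaleC_right adj_scaleC adj_ip
        scaleR_scaleC scaleC_scaleC scaleC_add_right algebra_simps)
qed

lemma mnorm_triangle: "mnorm (x + y) \<le> mnorm x + mnorm y"
proof (rule power2_le_imp_le)
  have "(mnorm (x + y))\<^sup>2 = norm (ip x x + (ip x y + ip y x) + ip y y)"
    by (simp add: mnorm_square ip_add_left ip_add_right algebra_simps)
  also have "\<dots> \<le> norm (ip x x) + (norm (ip x y) + norm (ip y x)) + norm (ip y y)"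
    by (intro norm_triangle_mono order_refl)
  also have "\<dots> \<le> (mnorm x)\<^sup>2 + (mnorm x * mnorm y + mnorm y * mnorm x) + (mnorm y)\<^sup>2"
    unfolding mnorm_square by (intro add_mono cauchy_schwarz order_refl)
  also have "\<dots> = (mnorm x + mnorm y)\<^sup>2" by (simp add: power2_eq_square algebra_simps)
  finally show "(mnorm (x + y))\<^sup>2 \<le> (mnorm x + mnorm y)\<^sup>2" .
qed (simp add: mnorm_nonneg)

lemma mnorm_diff_ge: "mnorm x - mnorm y \<le> mnorm (x - y)"
  using mnorm_triangle[of "x - y" y] by simp

text \<open>
  In \<open>\<langle>x + cy, x + cy\<rangle>\<close> the diagonal terms contribute at most \<open>\<parallel>x\<parallel>\<^sup>2 + \<parallel>y\<parallel>\<^sup>2\<close>, so the cross terms must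
  make up for \<open>2 \<parallel>x\<parallel> \<parallel>y\<parallel>\<close>, and Cauchy--Schwarz leaves no slack.
\<close>

lemma norm_ip_if_parallel:
  assumes c: "cmod c = 1" and par: "mnorm (x + c *\<^sub>C y) = mnorm x + mnorm y"
  shows "norm (c *\<^sub>C ip x y + adj (c *\<^sub>C ip x y)) = 2 * norm (ip x y)"
    and "norm (ip x y) = mnorm x * mnorm y"
proof -
  let ?k = "c *\<^sub>C ip x y + adj (c *\<^sub>C ip x y)"
  have "(mnorm x + mnorm y)\<^sup>2 = norm (ip x x + ?k + ip y y)"
    using ip_add_self[of x c y] c by (simp add: par[symmetric] mnorm_square)
  also have "\<dots> \<le> norm (ip x x) + norm ?k + norm (ip y y)"
    by (intro norm_triangle_mono order_refl)
  finally have ge: "2 * (mnorm x * mnorm y) \<le> norm ?k"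
    by (simp add: mnorm_square[symmetric] power2_eq_square algebra_simps)
  have le: "norm ?k \<le> 2 * norm (ip x y)"
    using norm_triangle_ineq[of "c *\<^sub>C ip x y" "adj (c *\<^sub>C ip x y)"] c by (simp add: norm_scaleC)
  show "norm ?k = 2 * norm (ip x y)" "norm (ip x y) = mnorm x * mnorm y"
    using ge le cauchy_schwarz[of x y] by linarith+
qed

lemma spectral_radius_if_parallel:
  assumes c: "cmod c = 1" and par: "mnorm (x + c *\<^sub>C y) = mnorm x + mnorm y"
  shows "spectral_radius (ip x y) = norm (ip x y)"
proof -
  let ?b = "unitize (c *\<^sub>C ip x y)"
  have nb: "norm ?b = norm (ip x y)" using c by (simp add: norm_scaleC)
  have "norm (?b + adj ?b) = 2 * norm ?b"
    using norm_ip_if_parallel(1)[OF c par] nb by (simp add: unitize_hom[symmetric])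
  then obtain z where z: "z \<in> unital_spectrum ?b" "cmod z = norm ?b"
    using exists_spectral_value norm_power_if_norm_add_adj by blast
  have "inverse c * z \<in> unital_spectrum (unitize (ip x y))"
    using unital_spectrum_scale[OF z(1), of "inverse c"] c
    by (cases "c = 0") (simp_all add: unitize_hom[symmetric] scaleC_scaleC)
  moreover have "cmod (inverse c * z) = norm (ip x y)"
    using z(2) nb c by (simp add: norm_mult norm_inverse)
  ultimately show ?thesis unfolding spectral_radius_eq_norm_iff by blast
qed

text \<open>
  Rescale to vectors \<open>X\<close>, \<open>Y\<close> of equal norm \<open>M = \<parallel>x\<parallel> \<parallel>y\<parallel>\<close>, and choose the phase \<open>d\<close> that rotates a
  spectral value of modulus \<open>M\<close> to the positive axis. Then
  \<open>\<langle>X + dY, X + dY\<rangle> = \<langle>X - dY, X - dY\<rangle> + k + k\<^sup>*\<close>, where \<open>\<parallel>k\<parallel> = 2M\<^sup>2\<close> is in the spectrum of \<open>k\<close>; the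
  first term on the right is positive, so \<open>\<parallel>X + dY\<parallel>\<^sup>2 \<ge> 2\<parallel>k\<parallel> = (2M)\<^sup>2\<close>. The triangle inequality
  transfers the equality \<open>\<parallel>X + dY\<parallel> = \<parallel>X\<parallel> + \<parallel>Y\<parallel>\<close> to the unscaled vectors.
\<close>

lemma parallel_if_spectral_radius:
  assumes r: "spectral_radius (ip x y) = norm (ip x y)"
    and eq: "norm (ip x y) = mnorm x * mnorm y"
  shows "\<exists>c. cmod c = 1 \<and> mnorm (x + c *\<^sub>C y) = mnorm x + mnorm y"
proof (cases "x = 0 \<or> y = 0")
  case True
  then show ?thesis
    using mnorm_eq_zero_iff[of 0] by (intro exI[of _ 1]) auto
next
  case False
  define p q where "p = mnorm x" and "q = mnorm y"
  have pq: "p > 0" "q > 0"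
    using False mnorm_nonneg mnorm_eq_zero_iff by (auto simp: p_def q_def less_le)
  define M where "M = p * q"
  have M: "M > 0" "norm (ip x y) = M" using pq eq by (auto simp: M_def p_def q_def)
  obtain z where z: "z \<in> unital_spectrum (unitize (ip x y))" "cmod z = M"
    using r M(2) unfolding spectral_radius_eq_norm_iff by auto
  define d where "d = of_real M / z"
  have z0: "z \<noteq> 0" using z M by auto
  have d: "cmod d = 1" "d * z = of_real M" using z M z0 by (auto simp: d_def norm_divide)
  define k where "k = (2 * M) *\<^sub>R (d *\<^sub>C ip x y)"
  have nk: "norm k = 2 * M * M" using M d by (simp add: k_def norm_scaleC)
  have spec: "complex_of_real (norm (unitize k)) \<in> unital_spectrum (unitize k)"
  proof -
    have "(of_real (2 * M) * d) * z \<in> unital_spectrum ((of_real (2 * M) * d) *\<^sub>C unitize (ip x y))"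
      using z(1) by (rule unital_spectrum_scale)
    also have "(of_real (2 * M) * d) *\<^sub>C unitize (ip x y) = unitize k"
      by (simp add: k_def unitize_hom[symmetric] scaleR_scaleC scaleC_scaleC)
    also have "of_real (2 * M) * d * z = complex_of_real (norm (unitize k))"
      using d(2) by (simp add: nk mult.assoc)
    finally show ?thesis .
  qed
  define X Y where "X = complex_of_real q *\<^sub>C x" and "Y = complex_of_real p *\<^sub>C y"
  define w where "w = ip (X + (- d) *\<^sub>C Y) (X + (- d) *\<^sub>C Y)"
  have dXY: "d *\<^sub>C ip X Y = M *\<^sub>R (d *\<^sub>C ip x y)"
    by (simp add: X_def Y_def M_def ip_scaleC_left ip_scaleC_right scaleR_scaleC scaleC_scaleC mult_ac)
  have k2: "k + adj k = 2 *\<^sub>R (d *\<^sub>C ip X Y + adj (d *\<^sub>C ip X Y))"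
    unfolding dXY by (simp add: k_def adj_scaleR scaleR_add_right)
  have "w + (k + adj k) = ip (X + d *\<^sub>C Y) (X + d *\<^sub>C Y)"
    unfolding w_def ip_add_self k2
    by (simp add: scaleC_minus_left adj_minus scaleR_2 algebra_simps)
  \<comment> \<open>The summand \<open>1\<close> keeps \<open>N\<close> positive when \<open>w = 0\<close>.\<close>
  moreover define N where "N = norm w + 1"
  then have "norm (complex_of_real N *\<^sub>C 1 + unitize (k + adj k)) \<le> N + norm (w + (k + adj k))"
    by (intro norm_real_add_le_if_positive) (simp_all add: w_def ip_positive)
  moreover have "N + 2 * norm (unitize k) \<le> norm (complex_of_real N *\<^sub>C 1 + (unitize k + adj (unitize k)))"
    using spec by (rule norm_add_real_part_ge) (simp add: N_def add_nonneg_pos)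
  ultimately have "2 * norm k \<le> (mnorm (X + d *\<^sub>C Y))\<^sup>2"
    by (simp add: unitize_hom mnorm_square)
  then have "(2 * M)\<^sup>2 \<le> (mnorm (X + d *\<^sub>C Y))\<^sup>2"
    by (simp add: nk power_mult_distrib power2_eq_square[of M])
  then have big: "2 * M \<le> mnorm (X + d *\<^sub>C Y)"
    by (rule power2_le_imp_le) (rule mnorm_nonneg)
  have "p + q \<le> mnorm (x + d *\<^sub>C y)"
  proof (cases "q \<le> p")
    case True
    have "X + d *\<^sub>C Y - complex_of_real (p - q) *\<^sub>C (d *\<^sub>C y) = complex_of_real q *\<^sub>C (x + d *\<^sub>C y)"
      by (simp add: X_def Y_def scaleC_add_right scaleC_diff_left scaleC_scaleC algebra_simps)
    then have "2 * M - (p - q) * q \<le> q * mnorm (x + d *\<^sub>C y)"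
      using mnorm_diff_ge[of "X + d *\<^sub>C Y" "complex_of_real (p - q) *\<^sub>C (d *\<^sub>C y)"] big True d pq
      by (simp add: mnorm_scaleC q_def[symmetric] del: of_real_diff)
    then have "q * (p + q) \<le> q * mnorm (x + d *\<^sub>C y)" by (simp add: M_def algebra_simps)
    then show ?thesis using pq by simp
  next
    case False
    have "X + d *\<^sub>C Y - complex_of_real (q - p) *\<^sub>C x = complex_of_real p *\<^sub>C (x + d *\<^sub>C y)"
      by (simp add: X_def Y_def scaleC_add_right scaleC_diff_left scaleC_scaleC algebra_simps)
    then have "2 * M - (q - p) * p \<le> p * mnorm (x + d *\<^sub>C y)"
      using mnorm_diff_ge[of "X + d *\<^sub>C Y" "complex_of_real (q - p) *\<^sub>C x"] big False d pq
      by (simp add: mnorm_scaleC p_def[symmetric] del: of_real_diff)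
    then have "p * (p + q) \<le> p * mnorm (x + d *\<^sub>C y)" by (simp add: M_def algebra_simps)
    then show ?thesis using pq by simp
  qed
  moreover have "mnorm (x + d *\<^sub>C y) \<le> p + q"
    using mnorm_triangle[of x "d *\<^sub>C y"] d by (simp add: mnorm_scaleC p_def q_def)
  ultimately show ?thesis using d by (auto simp: p_def q_def)
qed

text \<open>
  The triangle inequality gives \<open>\<parallel>2x + cy\<parallel> \<ge> 2\<parallel>x + cy\<parallel> - \<parallel>y\<parallel> = \<parallel>x\<parallel> + \<parallel>x + cy\<parallel>\<close>, so \<open>x\<close> is parallel to
  \<open>x + cy\<close> with factor \<open>1\<close> and the pair attains equality in Cauchy--Schwarz.
\<close>

lemma norm_ip_add_if_parallel:
  assumes c: "cmod c = 1" and par: "mnorm (x + c *\<^sub>C y) = mnorm x + mnorm y"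
  shows "norm (ip x (x + c *\<^sub>C y)) = mnorm x * (mnorm x + mnorm y)"
proof -
  let ?z = "x + c *\<^sub>C y"
  have "x + 1 *\<^sub>C ?z = 2 *\<^sub>C ?z - c *\<^sub>C y"
    using scaleC_add_left[of 1 1 ?z] by simp
  then have "2 * mnorm ?z - mnorm y \<le> mnorm (x + 1 *\<^sub>C ?z)"
    using mnorm_diff_ge[of "2 *\<^sub>C ?z" "c *\<^sub>C y"] c by (simp only: mnorm_scaleC) simp
  then have "mnorm (x + 1 *\<^sub>C ?z) = mnorm x + mnorm ?z"
    using par mnorm_triangle[of x ?z] by simp
  then show ?thesis
    using norm_ip_if_parallel(2)[of 1 x ?z] par by simp
qed

lemma parallel_if_norm_ip_add:
  assumes c: "cmod c = 1" and eq: "norm (ip x (x + c *\<^sub>C y)) = mnorm x * (mnorm x + mnorm y)"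
  shows "mnorm (x + c *\<^sub>C y) = mnorm x + mnorm y"
proof (cases "x = 0")
  case True
  then show ?thesis using c mnorm_eq_zero_iff[of 0] by (simp add: mnorm_scaleC)
next
  case False
  then have "mnorm x > 0" using mnorm_nonneg[of x] mnorm_eq_zero_iff[of x] by simp
  moreover have "mnorm x * (mnorm x + mnorm y) \<le> mnorm x * mnorm (x + c *\<^sub>C y)"
    using cauchy_schwarz[of x "x + c *\<^sub>C y"] eq by simp
  ultimately have "mnorm x + mnorm y \<le> mnorm (x + c *\<^sub>C y)" by simp
  then show ?thesis
    using mnorm_triangle[of x "c *\<^sub>C y"] c by (simp add: mnorm_scaleC)
qed

text \<open>
  Both \<open>\<parallel>\<langle>x, x\<rangle> + c\<langle>x, y\<rangle>\<parallel> \<le> \<parallel>\<langle>x, x\<rangle>\<parallel> + \<parallel>\<langle>x, y\<rangle>\<parallel>\<close> and \<open>\<parallel>\<langle>x, y\<rangle>\<parallel> \<le> \<parallel>x\<parallel> \<parallel>y\<parallel>\<close> are estimates in one chain, so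
  equality of the ends means equality in each.
\<close>

lemma norm_ip_add_iff:
  assumes c: "cmod c = 1"
  shows "norm (ip x (x + c *\<^sub>C y)) = mnorm x * (mnorm x + mnorm y) \<longleftrightarrow>
    norm (ip x x + c *\<^sub>C ip x y) = norm (ip x x) + norm (ip x y) \<and>
    norm (ip x y) = mnorm x * mnorm y"
proof -
  have "norm (ip x x + c *\<^sub>C ip x y) \<le> norm (ip x x) + norm (ip x y)"
    using norm_triangle_ineq[of "ip x x" "c *\<^sub>C ip x y"] c by (simp add: norm_scaleC)
  then show ?thesis
    using cauchy_schwarz[of x y]
    by (auto simp: ip_add_right ip_scaleC_right mnorm_square[symmetric] power2_eq_square algebra_simps)
qed

end

theorem theorem4p6:
  fixes act :: "'x::complex_vector \<Rightarrow> 'a::cstar_algebra \<Rightarrow> 'x"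
    and ip :: "'x \<Rightarrow> 'x \<Rightarrow> 'a"
    and x y :: 'x
  assumes "hilbert_module act ip"
  shows "(norm_parallel (ip_norm ip) x y \<longleftrightarrow>
            norm_parallel norm (ip x x) (ip x y) \<and>
            norm (ip x y) = ip_norm ip x * ip_norm ip y) \<and>
         (norm_parallel (ip_norm ip) x y \<longleftrightarrow>
            spectral_radius (ip x y) = norm (ip x y) \<and>
            norm (ip x y) = ip_norm ip x * ip_norm ip y) \<and>
         (norm_parallel (ip_norm ip) x y \<longleftrightarrow>
            (\<exists>c. cmod c = 1 \<and>
               norm (ip x (x + c *\<^sub>C y)) = ip_norm ip x * (ip_norm ip x + ip_norm ip y)))"
proof -
  interpret hilbert_module act ip by fact
  have iv: "norm_parallel (ip_norm ip) x y \<longleftrightarrow>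
      (\<exists>c. cmod c = 1 \<and> norm (ip x (x + c *\<^sub>C y)) = ip_norm ip x * (ip_norm ip x + ip_norm ip y))"
    unfolding norm_parallel_def using norm_ip_add_if_parallel parallel_if_norm_ip_add by blast
  moreover have "norm_parallel (ip_norm ip) x y \<longleftrightarrow>
      norm_parallel norm (ip x x) (ip x y) \<and> norm (ip x y) = ip_norm ip x * ip_norm ip y"
    unfolding iv unfolding norm_parallel_def using norm_ip_add_iff by blast
  moreover have "norm_parallel (ip_norm ip) x y \<longleftrightarrow>
      spectral_radius (ip x y) = norm (ip x y) \<and> norm (ip x y) = ip_norm ip x * ip_norm ip y"
    unfolding norm_parallel_def
    using norm_ip_if_parallel(2) spectral_radius_if_parallel parallel_if_spectral_radius by blast
  ultimately show ?thesis by blast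
qed

end
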